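(* Let $C$ be a $d$-variate Archimedean copula with generator $\phi$ and let $(U_1,\ldots,U_d)$ have distribution function $C$. For $0<s<1$ define $$L(s):=s\frac{\mathrm{d}}{\mathrm{d}s}\{s^{-1}\phi(1-s)\}=-\phi'(1-s)-s^{-1}\phi(1-s),\qquad g(s):=\frac{s\,L(s)}{\phi(1-s)}=-\frac{s\,\phi'(1-s)}{\phi(1-s)}-1.$$ If $\phi'(1)=0$ and if the function $L$ is positive and slowly varying at zero, then the function $g$ is positive and slowly varying at zero as well, $g(s)\to 0$ as $s\downarrow 0$, and for $(x_1,\ldots,x_d)\in(0,\infty)^d$, $$\lim_{s\downarrow 0}\frac{1}{s\,g(s)}\Pr[U_1\geq 1-s x_1,\ldots,U_d\geq 1-s x_d]=\sum_{\varnothing\neq I\subset\{1,\ldots,d\}}(-1)^{|I|}\Bigl(\sum_{i\in I}x_i\Bigr)\log\Bigl(\sum_{i\in I}x_i\Bigr)$$ $$=(d-2)!\int_0^{x_1}\cdots\int_0^{x_d}(t_1+\cdots+t_d)^{-(d-1)}\,\mathrm{d}t_1\cdots\mathrm{d}t_d.$$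
   Context: Fix an integer $d\geq 2$. An Archimedean generator is a convex, decreasing function $\phi:[0,1]\to[0,\infty]$ with $\phi(1)=0$; its generalized inverse is $\phi^{\leftarrow}(y)=\inf\{t\in[0,1]:\phi(t)\leq y\}$ for $y\in[0,\infty]$. The Archimedean copula with generator $\phi$ is $C(u_1,\ldots,u_d)=\phi^{\leftarrow}(\phi(u_1)+\cdots+\phi(u_d))$ on $[0,1]^d$; it is assumed throughout that $C$ is indeed a copula, i.e. (the restriction to $[0,1]^d$ of) a distribution function with uniform$(0,1)$ margins (equivalently, $\phi^{\leftarrow}$ is $d$-monotone on $(0,\infty)$). $\phi'$ denotes a non-decreasing version of the Radon-Nikodym derivative of $\phi$, and $\phi'(1)=-\lim_{s\downarrow 0}\phi(1-s)/s$. A positive measurable function $f$ on a right neighbourhood of zero is slowly varying at zero if $f(sx)/f(s)\to 1$ as $s\downarrow 0$ for every $x>0$. *)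

theory Defs
  imports "HOL-Probability.Probability"
begin

text \<open>Vectors in dimension d are functions on nat of which only the coordinates in {1..d} matter.
  Values of a generator outside [0,1] are irrelevant.\<close>

definition arch_generator :: "(real \<Rightarrow> ennreal) \<Rightarrow> bool" where
  "arch_generator \<phi> \<longleftrightarrow>
     (\<forall>a\<in>{0..1}. \<forall>b\<in>{0..1}. \<forall>t\<in>{0..1}.
        \<phi> ((1 - t) * a + t * b) \<le> ennreal (1 - t) * \<phi> a + ennreal t * \<phi> b) \<and>
     antimono_on {0..1} \<phi> \<and> \<phi> 1 = 0"

definition gen_inverse :: "(real \<Rightarrow> ennreal) \<Rightarrow> ennreal \<Rightarrow> real" where
  "gen_inverse \<phi> y = Inf {t \<in> {0..1}. \<phi> t \<le> y}"

definition arch_copula :: "nat \<Rightarrow> (real \<Rightarrow> ennreal) \<Rightarrow> (nat \<Rightarrow> real) \<Rightarrow> real" where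
  "arch_copula d \<phi> u = gen_inverse \<phi> (\<Sum>i=1..d. \<phi> (u i))"

definition joint_cdf :: "'a measure \<Rightarrow> nat \<Rightarrow> (nat \<Rightarrow> 'a \<Rightarrow> real) \<Rightarrow> (nat \<Rightarrow> real) \<Rightarrow> real" where
  "joint_cdf M d U u = measure M {\<omega> \<in> space M. \<forall>i\<in>{1..d}. U i \<omega> \<le> u i}"

text \<open>A copula is the restriction to the unit cube of the distribution function of a probability
  measure on d-space with uniform margins.\<close>

definition is_copula :: "nat \<Rightarrow> ((nat \<Rightarrow> real) \<Rightarrow> real) \<Rightarrow> bool" where
  "is_copula d C \<longleftrightarrow>
     (\<exists>\<mu> :: (nat \<Rightarrow> real) measure.
        prob_space \<mu> \<and> sets \<mu> = sets (PiM {1..d} (\<lambda>_. borel)) \<and>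
        (\<forall>i\<in>{1..d}. distr \<mu> borel (\<lambda>v. v i) = uniform_measure lborel {0<..<1}) \<and>
        (\<forall>u. (\<forall>i\<in>{1..d}. u i \<in> {0..1}) \<longrightarrow> joint_cdf \<mu> d (\<lambda>i v. v i) u = C u))"

text \<open>For a copula \<open>C\<close> the values on the unit cube determine the law: the point (1,...,1) has
  \<open>C\<close>-value 1, so the random vector lies almost surely in the cube.\<close>

definition has_copula_cdf ::
    "'a measure \<Rightarrow> nat \<Rightarrow> (nat \<Rightarrow> 'a \<Rightarrow> real) \<Rightarrow> ((nat \<Rightarrow> real) \<Rightarrow> real) \<Rightarrow> bool" where
  "has_copula_cdf M d U C \<longleftrightarrow>
     (\<forall>i\<in>{1..d}. U i \<in> borel_measurable M) \<and>
     (\<forall>u. (\<forall>i\<in>{1..d}. u i \<in> {0..1}) \<longrightarrow> joint_cdf M d U u = C u)"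

text \<open>\<open>\<phi>'\<close> is a non-decreasing version of the Radon-Nikodym derivative of \<open>\<phi>\<close>, with the conventional
  value at 1. When \<open>\<phi>\<close> generates a copula it is finite on (0,1], so \<^const>\<open>enn2real\<close> loses nothing
  there.\<close>

definition gen_deriv :: "(real \<Rightarrow> ennreal) \<Rightarrow> (real \<Rightarrow> real) \<Rightarrow> bool" where
  "gen_deriv \<phi> \<phi>' \<longleftrightarrow>
     mono_on {0<..<1} \<phi>' \<and>
     (\<forall>a b. 0 < a \<longrightarrow> a \<le> b \<longrightarrow> b \<le> 1 \<longrightarrow>
        set_integrable lborel {a..b} \<phi>' \<and>
        (LINT t:{a..b}|lborel. \<phi>' t) = enn2real (\<phi> b) - enn2real (\<phi> a)) \<and>
     ((\<lambda>s. enn2real (\<phi> (1 - s)) / s) \<longlongrightarrow> - \<phi>' 1) (at_right 0)"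

definition slowly_varying_at_0 :: "(real \<Rightarrow> real) \<Rightarrow> bool" where
  "slowly_varying_at_0 f \<longleftrightarrow>
     (\<exists>\<delta>>0. (\<forall>s\<in>{0<..<\<delta>}. 0 < f s) \<and> f \<in> borel_measurable (restrict_space borel {0<..<\<delta>})) \<and>
     (\<forall>x>0. ((\<lambda>s. f (s * x) / f s) \<longlongrightarrow> 1) (at_right 0))"

definition L_fun :: "(real \<Rightarrow> ennreal) \<Rightarrow> (real \<Rightarrow> real) \<Rightarrow> real \<Rightarrow> real" where
  "L_fun \<phi> \<phi>' s = - \<phi>' (1 - s) - enn2real (\<phi> (1 - s)) / s"

definition g_fun :: "(real \<Rightarrow> ennreal) \<Rightarrow> (real \<Rightarrow> real) \<Rightarrow> real \<Rightarrow> real" where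
  "g_fun \<phi> \<phi>' s = s * L_fun \<phi> \<phi>' s / enn2real (\<phi> (1 - s))"

text \<open>\<^const>\<open>L_fun\<close> is s times the derivative of \<open>\<phi> (1 - s) / s\<close> wherever the monotone function \<open>\<phi>'\<close>
  is continuous, hence for all but countably many s in (0,1).\<close>

lemma L_fun_derivative:
  assumes D: "gen_deriv \<phi> \<phi>'" and s: "0 < s" "s < 1" and c: "isCont \<phi>' (1 - s)"
  shows "((\<lambda>r. enn2real (\<phi> (1 - r)) / r) has_real_derivative L_fun \<phi> \<phi>' s / s) (at s)"
proof -
  define a where "a = (1 - s) / 2"
  have a: "0 < a" "a < 1 - s" "1 - s < 1" using s by (auto simp: a_def)
  have I: "set_integrable lborel {a..b} \<phi>'"
    and E: "(LINT t:{a..b}|lborel. \<phi>' t) = enn2real (\<phi> b) - enn2real (\<phi> a)"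
    if "a \<le> b" "b \<le> 1" for b
    using D a that unfolding gen_deriv_def by auto
  have H: "integral {a..b} \<phi>' = enn2real (\<phi> b) - enn2real (\<phi> a)" if "a \<le> b" "b \<le> 1" for b
    using set_borel_integral_eq_integral(2)[OF I[OF that]] E[OF that] by simp
  have "\<phi>' integrable_on {a..1}"
    using set_borel_integral_eq_integral(1)[OF I[of 1]] a by simp
  then have "((\<lambda>u. integral {a..u} \<phi>') has_vector_derivative \<phi>' (1 - s)) (at (1 - s) within {a..1})"
    using integral_has_vector_derivative_continuous_at[of \<phi>' a 1 "1 - s" "{}"] a c
    by (auto intro: continuous_at_imp_continuous_at_within)
  moreover have "at (1 - s) within {a..1} = at (1 - s)"
    using a by (intro at_within_interior) auto
  ultimately have 1: "((\<lambda>u. integral {a..u} \<phi>' + enn2real (\<phi> a)) has_real_derivative \<phi>' (1 - s)) (at (1 - s))"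
    by (auto simp: has_real_derivative_iff_has_vector_derivative intro!: derivative_eq_intros)
  have 2: "((\<lambda>u. enn2real (\<phi> u)) has_real_derivative \<phi>' (1 - s)) (at (1 - s))"
    by (rule has_field_derivative_transform_within_open[OF 1, of "{a<..<1}"]) (use a H in auto)
  have "((\<lambda>r. enn2real (\<phi> (1 - r))) has_real_derivative \<phi>' (1 - s) * (-1)) (at s)"
    by (rule DERIV_chain2[of _ _ "\<lambda>r. 1 - r", OF 2]) (auto intro!: derivative_eq_intros)
  from DERIV_divide[OF this DERIV_ident] s show ?thesis
    by (simp add: L_fun_def diff_divide_distrib)
qed

lemma g_fun_alt:
  assumes "enn2real (\<phi> (1 - s)) \<noteq> 0" "s \<noteq> 0"
  shows "g_fun \<phi> \<phi>' s = - (s * \<phi>' (1 - s)) / enn2real (\<phi> (1 - s)) - 1"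
  using assms by (simp add: g_fun_def L_fun_def field_simps)

end

theory Submission
  imports Defs "HOL-Real_Asymp.Real_Asymp"
begin

text \<open>Put \<open>f s = \<phi> (1 - s)\<close> and \<open>F s = f s / s\<close>. Since \<open>f\<close> is convex, increments of \<open>F\<close> are
  controlled by \<open>L\<close>, and slow variation of \<open>L\<close> gives \<open>(F (s x) - F s) / L s \<longrightarrow> ln x\<close>; hence \<open>g = L / F\<close>
  tends to 0 and is slowly varying. If \<open>f (s y) = \<Sum>i\<in>I. f (s x\<^sub>i)\<close>, so that \<open>1 - s y\<close> is the copula at the
  point with coordinates \<open>1 - s x\<^sub>i\<close> (\<open>i \<in> I\<close>) and 1 elsewhere, a linearisation of \<open>f\<close> yields
  \<open>y = X - g s (X ln X - \<Sum>i\<in>I. x\<^sub>i ln x\<^sub>i + o(1))\<close> with \<open>X = \<Sum>i\<in>I. x\<^sub>i\<close>. Inclusion--exclusion turns this into the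
  limit of the joint survival probability: all contributions that are additive over \<open>I\<close> cancel as
  \<open>d \<ge> 2\<close>. The integral formula is iterated integration of the \<open>d\<close>-th derivative of \<open>t ln t\<close> over a box
  shifted away from the singularity at the origin, followed by monotone convergence.\<close>

section \<open>De Haan expansion of the generator\<close>

lemma eventually_scaled_small: "\<forall>\<^sub>F s in at_right 0. 0 < s \<and> s < 1 \<and> s * c < 1" for c :: real
proof -
  have "((\<lambda>s. s * c) \<longlongrightarrow> 0 * c) (at_right 0)" by (intro tendsto_intros)
  then have "\<forall>\<^sub>F s in at_right 0. s * c < 1" by (auto dest: order_tendstoD(2)[where a = 1])
  then show ?thesis
    using eventually_at_right_real[of 0 1] by (auto elim: eventually_elim2)
qed

lemma filterlim_scale: "0 < x \<Longrightarrow> filterlim (\<lambda>s. s * x) (at_right 0) (at_right 0)" for x :: real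
  using filterlim_times_pos[OF filterlim_ident, of x 0 0] by (simp add: mult.commute)

lemma member_le_sum_pos:
  fixes x :: "'i \<Rightarrow> real"
  assumes "finite I" "j \<in> I" "\<And>i. i \<in> I \<Longrightarrow> 0 < x i"
  shows "x j \<le> sum x I"
  using assms by (intro member_le_sum) (auto intro: less_imp_le)

text \<open>Here \<open>f s\<close> plays the role of \<phi>(1 - s). Convexity enters as two
  supporting-line inequalities, one to the right and one to the left of the point where
  \<open>f'\<close> is taken, so \<open>f'\<close> only has to be a subgradient and \<open>f\<close>
  need not be differentiable.\<close>

locale de_haan_generator =
  fixes f f' L :: "real \<Rightarrow> real"
  assumes slope_le: "0 < s \<Longrightarrow> s \<le> t \<Longrightarrow> t < 1 \<Longrightarrow> (t - s) * f' s \<le> f t - f s"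
    and le_slope: "0 < s \<Longrightarrow> s \<le> t \<Longrightarrow> t < 1 \<Longrightarrow> f t - f s \<le> (t - s) * f' t"
    and nonneg: "0 < s \<Longrightarrow> s < 1 \<Longrightarrow> 0 \<le> f s"
    and L_eq: "L s = f' s - f s / s"
    and L_pos: "0 < s \<Longrightarrow> s < 1 \<Longrightarrow> 0 < L s"
    and L_slow: "0 < x \<Longrightarrow> ((\<lambda>s. L (s * x) / L s) \<longlongrightarrow> 1) (at_right 0)"
begin

section \<open>Convexity bounds for \<open>f\<close> and \<open>F\<close>\<close>

definition F :: "real \<Rightarrow> real" where "F s = f s / s"

lemma f'_mono:
  assumes "0 < s" "s \<le> t" "t < 1"
  shows "f' s \<le> f' t"
proof (cases "s = t")
  case False
  have "(t - s) * f' s \<le> (t - s) * f' t"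
    using slope_le[OF assms] le_slope[OF assms] by linarith
  then show ?thesis using False assms by (simp add: mult_le_cancel_left)
qed simp

lemma f'_pos:
  assumes "0 < s" "s < 1"
  shows "0 < f' s"
  using L_pos[OF assms] nonneg[OF assms] L_eq[of s] assms
  by (smt (verit) divide_nonneg_pos)

lemma strict_mono:
  assumes "0 < s" "s < t" "t < 1"
  shows "f s < f t"
proof -
  have "0 < (t - s) * f' s" using f'_pos[of s] assms by simp
  then show ?thesis using slope_le[of s t] assms by linarith
qed

lemma pos:
  assumes "0 < s" "s < 1"
  shows "0 < f s"
  using strict_mono[of "s / 2" s] nonneg[of "s / 2"] assms by simp

lemma F_pos: "0 < s \<Longrightarrow> s < 1 \<Longrightarrow> 0 < F s"
  by (simp add: F_def pos)

lemma f'_eq: "f' s = L s + F s"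
  by (simp add: L_eq F_def)

lemma f_eq: "0 < s \<Longrightarrow> f s = s * F s"
  by (simp add: F_def)

text \<open>A discrete form of F' = L / s. Inserting \<open>f_eq\<close> and \<open>f'_eq\<close>
  into the supporting line at the right endpoint, the terms \<open>t * F t\<close> cancel and
  \<open>s * (F t - F s)\<close> remains.\<close>

lemma F_diff_le:
  assumes "0 < s" "s \<le> t" "t < 1"
  shows "F t - F s \<le> (t / s - 1) * L t"
proof -
  have "t * F t - s * F s \<le> (t - s) * (L t + F t)"
    using le_slope[OF assms] assms by (simp add: f_eq f'_eq)
  then have "s * (F t - F s) \<le> (t - s) * L t" by (simp add: algebra_simps)
  then show ?thesis using assms by (simp add: field_simps)
qed

text \<open>The same cancellation with the supporting line at the left endpoint; now
  \<open>t\<close> is divided out, hence the factor \<open>1 - s / t\<close>.\<close>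

lemma le_F_diff:
  assumes "0 < s" "s \<le> t" "t < 1"
  shows "(1 - s / t) * L s \<le> F t - F s"
proof -
  have "(t - s) * (L s + F s) \<le> t * F t - s * F s"
    using slope_le[OF assms] assms by (simp add: f_eq f'_eq)
  then have "(t - s) * L s \<le> t * (F t - F s)" by (simp add: algebra_simps)
  then show ?thesis using assms by (simp add: field_simps)
qed

lemma F_mono:
  assumes "0 < s" "s \<le> t" "t < 1"
  shows "F s \<le> F t"
proof -
  have "0 \<le> (1 - s / t) * L s" using L_pos[of s] assms by simp
  then show ?thesis using le_F_diff[OF assms] by linarith
qed

text \<open>The monotonicity of \<open>f'\<close> on each cell of a geometric partition of \<open>[s, s x]\<close> replaces the
  uniform convergence theorem for slowly varying functions.\<close>

lemma F_diff_partition: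
  assumes "1 < l" "0 < s" "s * l ^ n < 1"
  shows "(\<Sum>k<n. (1 - 1 / l) * L (s * l ^ k)) \<le> F (s * l ^ n) - F s"
    and "F (s * l ^ n) - F s \<le> (\<Sum>k<n. (l - 1) * L (s * l ^ Suc k))"
proof -
  have small: "s * l ^ Suc k < 1" if "k < n" for k
  proof -
    have "s * l ^ Suc k \<le> s * l ^ n"
      using assms that by (intro mult_left_mono power_increasing) auto
    then show ?thesis using assms by linarith
  qed
  have tel: "F (s * l ^ n) - F s = (\<Sum>k<n. F (s * l ^ Suc k) - F (s * l ^ k))"
    using sum_lessThan_telescope[of "\<lambda>k. F (s * l ^ k)" n] by simp
  have le: "s * l ^ k \<le> s * l ^ Suc k" for k using assms by simp
  show "(\<Sum>k<n. (1 - 1 / l) * L (s * l ^ k)) \<le> F (s * l ^ n) - F s"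
    unfolding tel
  proof (rule sum_mono)
    fix k assume "k \<in> {..<n}"
    then show "(1 - 1 / l) * L (s * l ^ k) \<le> F (s * l ^ Suc k) - F (s * l ^ k)"
      using le_F_diff[OF _ le[of k]] small[of k] assms by simp
  qed
  show "F (s * l ^ n) - F s \<le> (\<Sum>k<n. (l - 1) * L (s * l ^ Suc k))"
    unfolding tel
  proof (rule sum_mono)
    fix k assume "k \<in> {..<n}"
    then show "F (s * l ^ Suc k) - F (s * l ^ k) \<le> (l - 1) * L (s * l ^ Suc k)"
      using F_diff_le[OF _ le[of k]] small[of k] assms by simp
  qed
qed

text \<open>For a fixed number \<open>n\<close> of cells only finitely many ratios of
  \<open>L\<close> occur and each tends to 1, so the quotient is asymptotically between
  \<open>n * (1 - 1 / l n)\<close> and \<open>n * (l n - 1)\<close>. Both bounds tend to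
  \<open>ln x\<close> as \<open>n\<close> grows; \<open>n\<close> is fixed before \<open>s\<close>
  goes to 0.\<close>

lemma F_diff_tendsto_gt_1:
  assumes x: "1 < x"
  shows "((\<lambda>s. (F (s * x) - F s) / L s) \<longlongrightarrow> ln x) (at_right 0)"
proof -
  \<comment> \<open>The n-th root of \<open>x\<close>: \<open>n\<close> cells of this ratio lead
    exactly from \<open>s\<close> to \<open>s * x\<close>.\<close>
  define l where "l n = exp (ln x / real n)" for n
  have l_gt: "1 < l n" and l_pow: "l n ^ n = x" if "0 < n" for n
    using x that by (auto simp: l_def exp_of_nat_mult[symmetric])
  have lnx: "0 < ln x" using x by simp
  have lower: "(\<lambda>n. real n * (1 - 1 / l n)) \<longlonglongrightarrow> ln x"
    unfolding l_def using lnx by real_asymp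
  have upper: "(\<lambda>n. real n * (l n - 1)) \<longlonglongrightarrow> ln x"
    unfolding l_def using lnx by real_asymp
  have bounds: "\<forall>\<^sub>F s in at_right 0.
      (\<Sum>k<n. (1 - 1 / l n) * (L (s * l n ^ k) / L s)) \<le> (F (s * x) - F s) / L s \<and>
      (F (s * x) - F s) / L s \<le> (\<Sum>k<n. (l n - 1) * (L (s * l n ^ Suc k) / L s))"
    if n: "0 < n" for n
    using eventually_scaled_small[of x]
  proof eventually_elim
    case (elim s)
    have "0 < L s" using L_pos elim by simp
    with F_diff_partition[OF l_gt[OF n], of s n] elim show ?case
      unfolding l_pow[OF n] by (simp add: divide_right_mono sum_divide_distrib[symmetric])
  qed
  have lowlim: "((\<lambda>s. \<Sum>k<n. (1 - 1 / l n) * (L (s * l n ^ k) / L s)) \<longlongrightarrow> real n * (1 - 1 / l n)) (at_right 0)"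
    and uplim: "((\<lambda>s. \<Sum>k<n. (l n - 1) * (L (s * l n ^ Suc k) / L s)) \<longlongrightarrow> real n * (l n - 1)) (at_right 0)"
    for n
  proof -
    have lim: "((\<lambda>s. c * (L (s * l n ^ k) / L s)) \<longlongrightarrow> c * 1) (at_right 0)" for k c
      by (intro tendsto_intros L_slow) (simp add: l_def)
    show "((\<lambda>s. \<Sum>k<n. (1 - 1 / l n) * (L (s * l n ^ k) / L s)) \<longlongrightarrow> real n * (1 - 1 / l n)) (at_right 0)"
      using tendsto_sum[where I = "{..<n}", OF lim[where c = "1 - 1 / l n"]] by simp
    show "((\<lambda>s. \<Sum>k<n. (l n - 1) * (L (s * l n ^ Suc k) / L s)) \<longlongrightarrow> real n * (l n - 1)) (at_right 0)"
      using tendsto_sum[where I = "{..<n}", OF lim[where c = "l n - 1" and k = "Suc k" for k]] by simp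
  qed
  show ?thesis
  proof (rule order_tendstoI)
    fix a assume "a < ln x"
    then have "\<forall>\<^sub>F n in sequentially. a < real n * (1 - 1 / l n) \<and> 0 < n"
      using order_tendstoD(1)[OF lower] eventually_gt_at_top[of 0] by (auto intro: eventually_conj)
    then obtain n where n: "a < real n * (1 - 1 / l n)" "0 < n"
      by (auto dest: eventually_happens)
    show "\<forall>\<^sub>F s in at_right 0. a < (F (s * x) - F s) / L s"
      using order_tendstoD(1)[OF lowlim n(1)] bounds[OF n(2)] by eventually_elim auto
  next
    fix a assume "ln x < a"
    then have "\<forall>\<^sub>F n in sequentially. real n * (l n - 1) < a \<and> 0 < n"
      using order_tendstoD(2)[OF upper] eventually_gt_at_top[of 0] by (auto intro: eventually_conj)
    then obtain n where n: "real n * (l n - 1) < a" "0 < n"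
      by (auto dest: eventually_happens)
    show "\<forall>\<^sub>F s in at_right 0. (F (s * x) - F s) / L s < a"
      using order_tendstoD(2)[OF uplim n(1)] bounds[OF n(2)] by eventually_elim auto
  qed
qed

text \<open>The case \<open>x < 1\<close> is the case \<open>1 / x\<close> read from the base point
  \<open>s * x\<close>; slow variation of \<open>L\<close> changes the normalisation from
  \<open>L (s * x)\<close> back to \<open>L s\<close>.\<close>

lemma F_diff_tendsto:
  assumes x: "0 < x"
  shows "((\<lambda>s. (F (s * x) - F s) / L s) \<longlongrightarrow> ln x) (at_right 0)"
proof -
  consider "1 < x" | "x = 1" | "x < 1" by linarith
  then show ?thesis
  proof cases
    case 1
    then show ?thesis by (rule F_diff_tendsto_gt_1)
  next
    case 2
    then show ?thesis by simp
  next
    case 3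
    then have "((\<lambda>s. (F (s * (1 / x)) - F s) / L s) \<longlongrightarrow> ln (1 / x)) (at_right 0)"
      using x by (intro F_diff_tendsto_gt_1) simp
    from filterlim_compose[OF this filterlim_scale[OF x]]
    have "((\<lambda>s. (F s - F (s * x)) / L (s * x)) \<longlongrightarrow> - ln x) (at_right 0)"
      using x by (simp add: ln_div)
    from tendsto_minus[OF tendsto_mult[OF this L_slow[OF x]]]
    have "((\<lambda>s. - ((F s - F (s * x)) / L (s * x) * (L (s * x) / L s))) \<longlongrightarrow> ln x) (at_right 0)"
      by simp
    moreover have "\<forall>\<^sub>F s in at_right 0.
        - ((F s - F (s * x)) / L (s * x) * (L (s * x) / L s)) = (F (s * x) - F s) / L s"
      using eventually_scaled_small[of x]
    proof eventually_elim
      case (elim s)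
      then have "L (s * x) \<noteq> 0" using L_pos[of "s * x"] x by simp
      then show ?case by (simp add: minus_divide_left)
    qed
    ultimately show ?thesis by (rule Lim_transform_eventually)
  qed
qed

section \<open>Asymptotics of \<open>g\<close>, \<open>F\<close> and \<open>f'\<close>\<close>

definition g :: "real \<Rightarrow> real" where "g s = L s / F s"

lemma g_pos: "0 < s \<Longrightarrow> s < 1 \<Longrightarrow> 0 < g s"
  by (simp add: g_def L_pos F_pos)

text \<open>Since \<open>F\<close> is positive, \<open>F s / L s\<close> exceeds
  \<open>(F s - F (s * x)) / L s\<close>, whose limit \<open>- ln x\<close> is as large as desired
  for small \<open>x\<close>.\<close>

lemma g_tendsto_0: "(g \<longlongrightarrow> 0) (at_right 0)"
proof -
  have "filterlim (\<lambda>s. F s / L s) at_top (at_right 0)"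
    unfolding filterlim_at_top
  proof
    fix Z :: real
    \<comment> \<open>Makes \<open>- ln x\<close> equal to \<open>Z + 1\<close>, leaving room above
      \<open>Z\<close>.\<close>
    define x where "x = exp (- (Z + 1))"
    have "((\<lambda>s. - ((F (s * x) - F s) / L s)) \<longlongrightarrow> Z + 1) (at_right 0)"
      using tendsto_minus[OF F_diff_tendsto[of x]] by (simp add: x_def add.commute)
    then have "\<forall>\<^sub>F s in at_right 0. Z < - ((F (s * x) - F s) / L s)"
      by (rule order_tendstoD) simp
    with eventually_scaled_small[of x] show "\<forall>\<^sub>F s in at_right 0. Z \<le> F s / L s"
    proof eventually_elim
      case (elim s)
      then have "0 \<le> F (s * x) / L s"
        using F_pos[of "s * x"] L_pos[of s] by (simp add: x_def)
      with elim show ?case by (simp add: diff_divide_distrib)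
    qed
  qed
  then have "((\<lambda>s. inverse (F s / L s)) \<longlongrightarrow> 0) (at_right 0)"
    by (intro tendsto_inverse_0_at_top)
  then show ?thesis by (simp add: g_def[abs_def])
qed

text \<open>The relative increment of \<open>F\<close> is its increment in units of
  \<open>L\<close>, which converges, times \<open>g\<close>, which vanishes.\<close>

lemma F_slow:
  assumes x: "0 < x"
  shows "((\<lambda>s. F (s * x) / F s) \<longlongrightarrow> 1) (at_right 0)"
proof -
  have "((\<lambda>s. 1 + (F (s * x) - F s) / L s * g s) \<longlongrightarrow> 1 + ln x * 0) (at_right 0)"
    by (intro tendsto_intros F_diff_tendsto[OF x] g_tendsto_0)
  moreover have "\<forall>\<^sub>F s in at_right 0. 1 + (F (s * x) - F s) / L s * g s = F (s * x) / F s"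
    using eventually_scaled_small[of x]
  proof eventually_elim
    case (elim s)
    then show ?case using L_pos[of s] F_pos[of s] by (simp add: g_def field_simps)
  qed
  ultimately show ?thesis by (auto intro: Lim_transform_eventually)
qed

lemma g_slow:
  assumes x: "0 < x"
  shows "((\<lambda>s. g (s * x) / g s) \<longlongrightarrow> 1) (at_right 0)"
proof -
  have "((\<lambda>s. (L (s * x) / L s) / (F (s * x) / F s)) \<longlongrightarrow> 1 / 1) (at_right 0)"
    by (intro tendsto_divide L_slow F_slow x) simp
  then show ?thesis by (simp add: g_def mult.commute)
qed

text \<open>In \<open>f' = L + F\<close> the summand \<open>L\<close> is negligible because
  \<open>g\<close> tends to 0. This lets the slopes in a linearisation of \<open>f\<close> be
  replaced by \<open>F s\<close>.\<close>

lemma f'_tendsto: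
  assumes x: "0 < x"
  shows "((\<lambda>s. F s / f' (s * x)) \<longlongrightarrow> 1) (at_right 0)"
proof -
  have "((\<lambda>s. inverse (L (s * x) / L s * g s + F (s * x) / F s)) \<longlongrightarrow> inverse (1 * 0 + 1)) (at_right 0)"
    by (intro tendsto_intros L_slow F_slow g_tendsto_0 x) simp
  moreover have "\<forall>\<^sub>F s in at_right 0.
      inverse (L (s * x) / L s * g s + F (s * x) / F s) = F s / f' (s * x)"
    using eventually_scaled_small[of x]
  proof eventually_elim
    case (elim s)
    then show ?case using L_pos[of s] F_pos[of s]
      by (simp add: g_def f'_eq add_divide_distrib[symmetric])
  qed
  ultimately show ?thesis by (auto intro: Lim_transform_eventually)
qed

section \<open>Inverting \<open>f\<close> at a sum of its values\<close>

lemma continuous: "continuous_on {0<..<1} f"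
proof (rule continuous_at_imp_continuous_on, rule ballI)
  fix t :: real assume t: "t \<in> {0<..<1}"
  \<comment> \<open>Any point strictly between \<open>t\<close> and 1 would do: since
    \<open>f'\<close> is monotone, \<open>f' b\<close> is a Lipschitz constant for \<open>f\<close>
    to the left of \<open>b\<close>.\<close>
  define b where "b = (t + 1) / 2"
  have b: "0 < b" "t < b" "b < 1" using t by (auto simp: b_def)
  have lip: "\<bar>f u - f v\<bar> \<le> \<bar>u - v\<bar> * f' b" if uv: "0 < u" "u \<le> b" "0 < v" "v \<le> b" for u v
  proof -
    have *: "\<bar>f u - f v\<bar> \<le> \<bar>u - v\<bar> * f' b" if "0 < u" "u \<le> v" "v \<le> b" for u v
    proof -
      have mono: "f' v \<le> f' b" using that b by (intro f'_mono) auto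
      have "(v - u) * f' v \<le> (v - u) * f' b" using that mono by (intro mult_left_mono) auto
      moreover have "f u \<le> f v"
        using strict_mono[of u v] that b by (cases "u = v") auto
      ultimately show ?thesis using le_slope[of u v] that b by simp
    qed
    show ?thesis using *[of u v] *[of v u] uv by (cases "u \<le> v") (auto simp: abs_minus_commute)
  qed
  have "((\<lambda>u. \<bar>u - t\<bar> * f' b) \<longlongrightarrow> 0) (at t)"
    by (auto intro!: tendsto_eq_intros)
  then have "((\<lambda>u. f u - f t) \<longlongrightarrow> 0) (at t)"
  proof (rule Lim_null_comparison[rotated])
    have "\<forall>\<^sub>F u in at t. u \<in> {0<..<b}"
      using t b by (intro eventually_at_in_open') auto
    then show "\<forall>\<^sub>F u in at t. norm (f u - f t) \<le> \<bar>u - t\<bar> * f' b"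
      by eventually_elim (use lip t b in auto)
  qed
  then show "isCont f t" by (simp add: isCont_def LIM_zero_iff)
qed

text \<open>The second bound is superadditivity of \<open>f\<close>, a consequence of
  \<open>F_mono\<close>: every \<open>F (s * x i)\<close> is at most
  \<open>F (s * sum x I)\<close>.\<close>

lemma scaled_sum_between:
  assumes I: "finite I" "j \<in> I" and x: "\<And>i. i \<in> I \<Longrightarrow> 0 < x i" and s: "0 < s" "s * sum x I < 1"
  shows "f (s * x j) \<le> (\<Sum>i\<in>I. f (s * x i))" "(\<Sum>i\<in>I. f (s * x i)) \<le> f (s * sum x I)"
proof -
  note le = member_le_sum_pos[of I _ x, OF I(1) _ x]
  then have small: "s * x i \<le> s * sum x I" "s * x i < 1" if "i \<in> I" for i
    using s mult_left_mono[OF le[OF that], of s] by linarith+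
  show "f (s * x j) \<le> (\<Sum>i\<in>I. f (s * x i))"
    using I x s small by (intro member_le_sum nonneg) auto
  have "(\<Sum>i\<in>I. f (s * x i)) \<le> (\<Sum>i\<in>I. s * x i * F (s * sum x I))"
    using x s small F_mono by (intro sum_mono) (auto simp: f_eq)
  also have "\<dots> = s * sum x I * F (s * sum x I)"
    by (simp add: sum_distrib_left sum_distrib_right)
  also have "\<dots> = f (s * sum x I)"
    using s x[OF I(2)] le[OF I(2)] by (simp add: f_eq)
  finally show "(\<Sum>i\<in>I. f (s * x i)) \<le> f (s * sum x I)" .
qed

lemma ex_inverse_sum:
  assumes I: "finite I" "j \<in> I" and x: "\<And>i. i \<in> I \<Longrightarrow> 0 < x i" and s: "0 < s" "s * sum x I < 1"
  shows "\<exists>v. s * x j \<le> v \<and> v \<le> s * sum x I \<and> f v = (\<Sum>i\<in>I. f (s * x i))"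
proof -
  note b = scaled_sum_between[OF assms]
  have "continuous_on {s * x j..s * sum x I} f"
    using s x[OF I(2)] by (intro continuous_on_subset[OF continuous]) (auto intro: less_le_trans[OF mult_pos_pos])
  with b s member_le_sum_pos[of I j x, OF I x] show ?thesis using IVT'[of f "s * x j" _ "s * sum x I"] by auto
qed

text \<open>\<open>N s\<close> measures the gap between \<open>f (s * X)\<close> and the sum in
  units of \<open>s * L s\<close>. By convexity this gap is \<open>s * (X - y s)\<close> times a
  slope between \<open>f' (s * x j)\<close> and \<open>f' (s * X)\<close>. Both slopes are
  asymptotic to \<open>F s\<close>, which turns the unit \<open>L s\<close> into
  \<open>g s\<close>.\<close>

lemma inverse_sum_tendsto:
  assumes I: "finite I" "j \<in> I" and x: "\<And>i. i \<in> I \<Longrightarrow> 0 < x i"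
    and y: "\<forall>\<^sub>F s in at_right 0. x j \<le> y s \<and> y s \<le> sum x I \<and> f (s * y s) = (\<Sum>i\<in>I. f (s * x i))"
  shows "((\<lambda>s. (sum x I - y s) / g s) \<longlongrightarrow> sum x I * ln (sum x I) - (\<Sum>i\<in>I. x i * ln (x i))) (at_right 0)"
proof -
  define X where "X = sum x I"
  define N where "N s = (f (s * X) - (\<Sum>i\<in>I. f (s * x i))) / (s * L s)" for s
  have xj: "0 < x j" and X: "0 < X"
    using I x unfolding X_def by (auto intro!: sum_pos)
  \<comment> \<open>\<open>F s\<close> is inserted so that \<open>F_diff_tendsto\<close> applies to
    both quotients. It cancels in each summand, and as the weights \<open>x i\<close> add up to
    \<open>X\<close>, what is left is \<open>N s\<close>.\<close>
  have "((\<lambda>s. \<Sum>i\<in>I. x i * ((F (s * X) - F s) / L s - (F (s * x i) - F s) / L s))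
      \<longlongrightarrow> (\<Sum>i\<in>I. x i * (ln X - ln (x i)))) (at_right 0)"
    by (intro tendsto_intros F_diff_tendsto x X)
  moreover have "(\<Sum>i\<in>I. x i * (ln X - ln (x i))) = X * ln X - (\<Sum>i\<in>I. x i * ln (x i))"
    by (simp add: right_diff_distrib sum_subtractf X_def sum_distrib_right)
  moreover have "\<forall>\<^sub>F s in at_right 0.
      (\<Sum>i\<in>I. x i * ((F (s * X) - F s) / L s - (F (s * x i) - F s) / L s)) = N s"
    using eventually_scaled_small[of X]
  proof eventually_elim
    case (elim s)
    have "(\<Sum>i\<in>I. x i * ((F (s * X) - F s) / L s - (F (s * x i) - F s) / L s))
        = (\<Sum>i\<in>I. x i * F (s * X) - x i * F (s * x i)) / L s"
      unfolding sum_divide_distrib by (intro sum.cong refl) (simp add: diff_divide_distrib right_diff_distrib)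
    also have "\<dots> = s * (X * F (s * X) - (\<Sum>i\<in>I. x i * F (s * x i))) / (s * L s)"
      using elim by (simp add: sum_subtractf X_def sum_distrib_right)
    also have "\<dots> = N s"
      using elim X x by (simp add: N_def f_eq right_diff_distrib sum_distrib_left mult.assoc)
    finally show ?case .
  qed
  ultimately have N: "(N \<longlongrightarrow> X * ln X - (\<Sum>i\<in>I. x i * ln (x i))) (at_right 0)"
    by (auto intro: Lim_transform_eventually)
  have lim: "((\<lambda>s. N s * (F s / f' (s * c))) \<longlongrightarrow> X * ln X - (\<Sum>i\<in>I. x i * ln (x i))) (at_right 0)"
    if "0 < c" for c
    using tendsto_mult[OF N f'_tendsto[OF that]] by simp
  have "\<forall>\<^sub>F s in at_right 0. N s * (F s / f' (s * X)) \<le> (X - y s) / g s \<and>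
      (X - y s) / g s \<le> N s * (F s / f' (s * x j))"
    using eventually_scaled_small[of X] y
  proof eventually_elim
    case (elim s)
    then have yb: "x j \<le> y s" "y s \<le> X" "s * y s \<le> s * X" "s * x j \<le> s * y s" "0 < s * y s"
      using xj by (auto simp: X_def)
    have sj: "0 < s * x j" using elim xj by simp
    have small: "s * x j < 1" "s * y s < 1" "s * X < 1" "0 < s * X"
      using yb sj elim by linarith+
    have sl: "f' (s * x j) \<le> f' (s * y s)" by (rule f'_mono[OF sj yb(4) small(2)])
    have pos: "0 < L s" "0 < F s" "0 < f' (s * X)" "0 < f' (s * x j)"
      using elim by (auto intro: L_pos F_pos f'_pos sj small)
    \<comment> \<open>The limit of slopes is known only at fixed multiples of \<open>s\<close>, so
      the slope at the moving point \<open>s * y s\<close> is bounded by the one at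
      \<open>s * x j\<close>.\<close>
    have "(s * X - s * y s) * f' (s * x j) \<le> (s * X - s * y s) * f' (s * y s)"
      using sl yb elim by (intro mult_left_mono) auto
    also have "\<dots> \<le> f (s * X) - f (s * y s)"
      by (rule slope_le[OF yb(5,3) small(3)])
    finally have 1: "(s * X - s * y s) * f' (s * x j) \<le> f (s * X) - f (s * y s)" .
    have 2: "f (s * X) - f (s * y s) \<le> (s * X - s * y s) * f' (s * X)"
      by (rule le_slope[OF yb(5,3) small(3)])
    have Neq: "f (s * X) - f (s * y s) = N s * L s * s"
      using elim pos by (simp add: N_def)
    have "(X - y s) * f' (s * x j) * s \<le> N s * L s * s" "N s * L s * s \<le> (X - y s) * f' (s * X) * s"
      using 1 2 unfolding Neq by (simp_all add: algebra_simps)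
    then have 3: "(X - y s) * f' (s * x j) \<le> N s * L s" "N s * L s \<le> (X - y s) * f' (s * X)"
      using elim by simp_all
    then have "X - y s \<le> N s * L s / f' (s * x j)" "N s * L s / f' (s * X) \<le> X - y s"
      using pos by (simp_all add: field_simps)
    moreover have "N s * (F s / c) = N s * L s / c * (F s / L s)" for c using pos by simp
    moreover have "(X - y s) / g s = (X - y s) * (F s / L s)" by (simp add: g_def)
    moreover have "0 \<le> F s / L s" using pos by simp
    ultimately show ?case by (simp only: mult_right_mono)
  qed
  then have "((\<lambda>s. (X - y s) / g s) \<longlongrightarrow> X * ln X - (\<Sum>i\<in>I. x i * ln (x i))) (at_right 0)"
    by (intro tendsto_sandwich[OF _ _ lim[OF X] lim[OF xj]]) (auto elim: eventually_mono)
  then show ?thesis by (simp add: X_def)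
qed

end

section \<open>Alternating sums and box integrals\<close>

text \<open>Pairs each \<open>I\<close> with \<open>insert j I\<close>, whose sign is opposite. It
  drives the cancellations below and the induction for box integrals.\<close>

lemma sum_Pow_insert_alternating:
  fixes h :: "'i set \<Rightarrow> real"
  assumes "finite A" "j \<notin> A"
  shows "(\<Sum>I\<in>Pow (insert j A). (-1) ^ card I * h I) = (\<Sum>I\<in>Pow A. (-1) ^ card I * (h I - h (insert j I)))"
proof -
  have inj: "inj_on (insert j) (Pow A)" using assms by (auto simp: inj_on_def)
  have "(\<Sum>I\<in>Pow (insert j A). (-1) ^ card I * h I)
      = (\<Sum>I\<in>Pow A. (-1) ^ card I * h I) + (\<Sum>I\<in>insert j ` Pow A. (-1) ^ card I * h I)"
    unfolding Pow_insert using assms by (intro sum.union_disjoint) auto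
  also have "(\<Sum>I\<in>insert j ` Pow A. (-1) ^ card I * h I) = (\<Sum>I\<in>Pow A. - ((-1) ^ card I * h (insert j I)))"
    unfolding sum.reindex[OF inj] o_def
  proof (rule sum.cong)
    fix I assume "I \<in> Pow A"
    then have "finite I" "j \<notin> I" using assms by (auto intro: finite_subset)
    then show "(-1) ^ card (insert j I) * h (insert j I) = - ((-1) ^ card I * h (insert j I))" by simp
  qed simp
  finally show ?thesis by (simp add: right_diff_distrib sum_subtractf sum_negf)
qed

lemma sum_Pow_alternating:
  assumes "finite A" "A \<noteq> {}"
  shows "(\<Sum>I\<in>Pow A. (-1) ^ card I :: real) = 0"
proof -
  obtain j where "j \<in> A" using assms by auto
  then show ?thesis
    using sum_Pow_insert_alternating[of "A - {j}" j "\<lambda>_. 1"] assms by (simp add: insert_absorb)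
qed

text \<open>Splitting off \<open>j\<close> leaves the constant difference \<open>- w j\<close>; the
  signs then cancel over the subsets of the remaining set, which is nonempty because
  \<open>card A\<close> is at least 2.\<close>

lemma sum_Pow_alternating_sum:
  fixes w :: "'i \<Rightarrow> real"
  assumes "finite A" "2 \<le> card A"
  shows "(\<Sum>I\<in>Pow A. (-1) ^ card I * sum w I) = 0"
proof -
  obtain j where j: "j \<in> A" using assms by (cases "A = {}") auto
  define B where "B = A - {j}"
  have B: "finite B" "j \<notin> B" "A = insert j B" using assms j by (auto simp: B_def)
  then have ne: "B \<noteq> {}" using assms by auto
  have "(\<Sum>I\<in>Pow A. (-1) ^ card I * sum w I) = (\<Sum>I\<in>Pow B. (-1) ^ card I * (sum w I - sum w (insert j I)))"
    unfolding B(3) by (rule sum_Pow_insert_alternating[OF B(1,2)])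
  also have "\<dots> = (\<Sum>I\<in>Pow B. (-1) ^ card I * - w j)"
  proof (rule sum.cong)
    fix I assume "I \<in> Pow B"
    then have "finite I" "j \<notin> I" using B by (auto intro: finite_subset)
    then show "(-1) ^ card I * (sum w I - sum w (insert j I)) = (-1) ^ card I * - w j" by simp
  qed simp
  also have "\<dots> = 0"
    unfolding sum_distrib_right[symmetric] sum_Pow_alternating[OF B(1) ne] by simp
  finally show ?thesis .
qed

text \<open>Expand the product of the factors \<open>1 - indicat_real (A i)\<close> over subsets and
  integrate; the empty subset contributes the whole space.\<close>

lemma (in finite_measure) inclusion_exclusion_compl:
  assumes J: "finite J" and A: "\<And>i. i \<in> J \<Longrightarrow> A i \<in> sets M"
  shows "measure M {\<omega> \<in> space M. \<forall>i\<in>J. \<omega> \<notin> A i}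
    = (\<Sum>I\<in>Pow J. (-1) ^ card I * measure M {\<omega> \<in> space M. \<forall>i\<in>I. \<omega> \<in> A i})"
proof -
  have m: "{\<omega> \<in> space M. \<forall>i\<in>I. \<omega> \<in> A i} \<in> sets M" if "I \<subseteq> J" for I
    using that J A by (intro sets.sets_Collect_finite_All) (auto intro: finite_subset simp: Int_def[symmetric])
  have m': "{\<omega> \<in> space M. \<forall>i\<in>J. \<omega> \<notin> A i} \<in> sets M"
    using J A by (intro sets.sets_Collect_finite_All sets.sets_Collect_neg) (auto simp: Int_def[symmetric])
  have ind: "indicat_real {\<omega> \<in> space M. \<forall>i\<in>I. \<omega> \<in> A i} \<omega> = (\<Prod>i\<in>I. indicat_real (A i) \<omega>)"
    if "\<omega> \<in> space M" "finite I" for \<omega> I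
    using that by (auto simp: indicator_def prod_zero_iff)
  have "measure M {\<omega> \<in> space M. \<forall>i\<in>J. \<omega> \<notin> A i} = (LINT \<omega>|M. indicator {\<omega> \<in> space M. \<forall>i\<in>J. \<omega> \<notin> A i} \<omega>)"
    using m' by simp
  also have "\<dots> = (LINT \<omega>|M. (\<Sum>I\<in>Pow J. (-1) ^ card I * indicator {\<omega> \<in> space M. \<forall>i\<in>I. \<omega> \<in> A i} \<omega>))"
  proof (rule Bochner_Integration.integral_cong[OF refl])
    fix \<omega> assume w: "\<omega> \<in> space M"
    have "indicat_real {\<omega> \<in> space M. \<forall>i\<in>J. \<omega> \<notin> A i} \<omega> = (\<Prod>i\<in>J. 1 - indicat_real (A i) \<omega>)"
      using w J by (auto simp: indicator_def prod_zero_iff)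
    also have "\<dots> = (\<Sum>I\<in>Pow J. (-1) ^ card I * (\<Prod>i\<in>I. indicat_real (A i) \<omega>))"
      by (simp add: prod_diff_conv_sum J)
    also have "\<dots> = (\<Sum>I\<in>Pow J. (-1) ^ card I * indicator {\<omega> \<in> space M. \<forall>i\<in>I. \<omega> \<in> A i} \<omega>)"
      using w J by (intro sum.cong refl) (auto simp: ind finite_subset)
    finally show "indicat_real {\<omega> \<in> space M. \<forall>i\<in>J. \<omega> \<notin> A i} \<omega> = \<dots>" .
  qed
  also have "\<dots> = (\<Sum>I\<in>Pow J. (LINT \<omega>|M. (-1) ^ card I * indicat_real {\<omega> \<in> space M. \<forall>i\<in>I. \<omega> \<in> A i} \<omega>))"
    using m by (intro Bochner_Integration.integral_sum integrable_mult_right integrable_real_indicator)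
      (auto simp: emeasure_eq_measure)
  also have "\<dots> = (\<Sum>I\<in>Pow J. (-1) ^ card I * measure M {\<omega> \<in> space M. \<forall>i\<in>I. \<omega> \<in> A i})"
    using m by (intro sum.cong refl) simp
  finally show ?thesis .
qed

text \<open>Induction on \<open>J\<close>, integrating out one coordinate at a time. Owing to the
  minus sign in \<open>deriv\<close>, each integration gives the value at the lower endpoint minus
  that at the upper one, the difference in \<open>sum_Pow_insert_alternating\<close>. The upper
  endpoint shifts \<open>c\<close> by \<open>x j\<close>, so \<open>c\<close> varies in the
  induction; \<open>0 < c\<close> keeps the argument where \<open>K\<close> is smooth.\<close>

lemma integral_box_sum:
  fixes K :: "nat \<Rightarrow> real \<Rightarrow> real" and x :: "'i \<Rightarrow> real"
  assumes J: "finite J" and x: "\<And>i. i \<in> J \<Longrightarrow> 0 \<le> x i" and c: "0 < c"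
    and deriv: "\<And>n t. 0 < t \<Longrightarrow> (K n has_real_derivative - K (Suc n) t) (at t)"
    and meas: "\<And>n. K n \<in> borel_measurable borel"
  shows "set_integrable (PiM J (\<lambda>_. lborel)) (PiE J (\<lambda>i. {0..x i})) (\<lambda>t. K n (c + (\<Sum>i\<in>J. t i)))"
    and "(LINT t : PiE J (\<lambda>i. {0..x i}) | PiM J (\<lambda>_. lborel). K (k + card J) (c + (\<Sum>i\<in>J. t i)))
      = (\<Sum>I\<in>Pow J. (-1) ^ card I * K k (c + sum x I))"
proof -
  interpret product_sigma_finite "\<lambda>_. lborel :: real measure" ..
  have cont: "isCont (K n) t" if "0 < t" for n t
    using deriv[OF that] by (rule DERIV_isCont)
  \<comment> \<open>Proved for all \<open>A\<close> and \<open>c\<close>: the induction needs it on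
    \<open>insert j A\<close> for Fubini, and on \<open>A\<close> with the shifts \<open>c\<close>
    and \<open>c + x j\<close>.\<close>
  have integrable: "set_integrable (PiM A (\<lambda>_. lborel)) (PiE A (\<lambda>i. {0..x i})) (\<lambda>t. K n (c + (\<Sum>i\<in>A. t i)))"
    if A: "finite A" and x: "\<And>i. i \<in> A \<Longrightarrow> 0 \<le> x i" and c: "0 < c" for A n c
  proof -
    have "continuous_on {c..c + sum x A} (K n)"
      using c by (intro continuous_at_imp_continuous_on ballI cont) auto
    then have "bounded (K n ` {c..c + sum x A})"
      by (intro compact_imp_bounded compact_continuous_image) auto
    then obtain B where "\<forall>y\<in>K n ` {c..c + sum x A}. norm y \<le> B"
      unfolding bounded_iff by blast
    then have B: "\<bar>K n u\<bar> \<le> B" if "u \<in> {c..c + sum x A}" for u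
      using that by simp
    have box[measurable]: "PiE A (\<lambda>i. {0..x i}) \<in> sets (PiM A (\<lambda>_. lborel))"
      using A by (intro sets_PiM_I_finite) auto
    have fin: "emeasure (PiM A (\<lambda>_. lborel)) (PiE A (\<lambda>i. {0..x i})) < \<infinity>"
      using A x by (subst emeasure_PiM) (auto simp: prod_ennreal)
    note meas[measurable]
    have "integrable (PiM A (\<lambda>_. lborel)) (\<lambda>t. B * indicator (PiE A (\<lambda>i. {0..x i})) t)"
      using fin by (intro integrable_mult_right integrable_real_indicator) auto
    then show ?thesis
      unfolding set_integrable_def
    proof (rule Bochner_Integration.integrable_bound)
      show "(\<lambda>t. indicat_real (PiE A (\<lambda>i. {0..x i})) t *\<^sub>R K n (c + (\<Sum>i\<in>A. t i)))
          \<in> borel_measurable (PiM A (\<lambda>_. lborel))"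
        by measurable
      have "\<bar>K n (c + (\<Sum>i\<in>A. t i))\<bar> \<le> \<bar>B\<bar>" if "t \<in> PiE A (\<lambda>i. {0..x i})" for t
        using that by (intro order_trans[OF B abs_ge_self]) (auto intro!: sum_nonneg sum_mono simp: PiE_iff)
      then show "AE t in PiM A (\<lambda>_. lborel). norm (indicat_real (PiE A (\<lambda>i. {0..x i})) t *\<^sub>R K n (c + (\<Sum>i\<in>A. t i)))
          \<le> norm (B * indicator (PiE A (\<lambda>i. {0..x i})) t)"
        by (auto simp: indicator_def)
    qed
  qed
  show "set_integrable (PiM J (\<lambda>_. lborel)) (PiE J (\<lambda>i. {0..x i})) (\<lambda>t. K n (c + (\<Sum>i\<in>J. t i)))"
    by (rule integrable[OF J x c])
  show "(LINT t : PiE J (\<lambda>i. {0..x i}) | PiM J (\<lambda>_. lborel). K (k + card J) (c + (\<Sum>i\<in>J. t i)))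
      = (\<Sum>I\<in>Pow J. (-1) ^ card I * K k (c + sum x I))"
    using J x c
  proof (induction J arbitrary: c rule: finite_induct)
    case empty
    have [measurable]: "PiE {} (\<lambda>i. {0..x i}) \<in> sets (PiM {} (\<lambda>_. lborel :: real measure))"
      by (intro sets_PiM_I_finite) auto
    show ?case by (simp add: set_lebesgue_integral_def PiM_empty lebesgue_integral_count_space_finite)
  next
    case (insert j A)
    let ?n = "k + card A"
    have xj: "0 \<le> x j" and xA: "\<And>i. i \<in> A \<Longrightarrow> 0 \<le> x i" using insert by auto
    \<comment> \<open>Outside the box over \<open>A\<close> both sides vanish; inside, this is the
      fundamental theorem of calculus with antiderivative \<open>- K ?n\<close>.\<close>
    have inner: "(LINT u|lborel. indicator (PiE (insert j A) (\<lambda>i. {0..x i})) (t(j := u)) *\<^sub>R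
          K (Suc ?n) (c + (\<Sum>i\<in>insert j A. (t(j := u)) i)))
        = indicator (PiE A (\<lambda>i. {0..x i})) t *\<^sub>R K ?n (c + (\<Sum>i\<in>A. t i))
          - indicator (PiE A (\<lambda>i. {0..x i})) t *\<^sub>R K ?n (c + x j + (\<Sum>i\<in>A. t i))"
      if t: "t \<in> space (PiM A (\<lambda>_. lborel))" for t
    proof (cases "t \<in> PiE A (\<lambda>i. {0..x i})")
      case False
      have "t(j := u) \<notin> PiE (insert j A) (\<lambda>i. {0..x i})" for u
      proof
        assume a: "t(j := u) \<in> PiE (insert j A) (\<lambda>i. {0..x i})"
        have "t i \<in> {0..x i}" if "i \<in> A" for i
          using PiE_mem[OF a, of i] that insert.hyps by (auto split: if_splits)
        then have "t \<in> PiE A (\<lambda>i. {0..x i})" using t by (auto simp: space_PiM PiE_iff)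
        with False show False ..
      qed
      with False show ?thesis by simp
    next
      case True
      define S where "S = (\<Sum>i\<in>A. t i)"
      have S: "0 \<le> S" using True by (auto simp: S_def PiE_iff intro!: sum_nonneg)
      have ind: "indicator (PiE (insert j A) (\<lambda>i. {0..x i})) (t(j := u)) = indicat_real {0..x j} u" for u
        using True insert.hyps by (auto simp: indicator_def PiE_iff extensional_def split: if_splits)
      have sum: "(\<Sum>i\<in>insert j A. (t(j := u)) i) = u + S" for u
        using insert.hyps unfolding S_def by (auto intro!: sum.cong)
      have "(LINT u|lborel. K (Suc ?n) (c + S + u) * indicat_real {0..x j} u)
          = - K ?n (c + S + x j) - - K ?n (c + S + 0)"
      proof (rule integral_FTC_Icc_real[OF xj])
        fix u assume u: "0 \<le> u" "u \<le> x j"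
        then have p: "0 < c + S + u" using S insert.prems by simp
        show "((\<lambda>u. - K ?n (c + S + u)) has_real_derivative K (Suc ?n) (c + S + u)) (at u)"
          by (intro DERIV_cong[OF DERIV_minus[OF DERIV_chain2[where f = "K ?n" and g = "\<lambda>u. c + S + u" and x = u, OF deriv[OF p]]]])
            (auto intro!: derivative_eq_intros)
        show "isCont (\<lambda>u. K (Suc ?n) (c + S + u)) u"
          using p by (intro isCont_o2[OF _ cont] continuous_intros) auto
      qed
      then show ?thesis unfolding sum ind using True by (simp add: S_def[symmetric] ac_simps)
    qed
    have "(LINT t : PiE (insert j A) (\<lambda>i. {0..x i}) | PiM (insert j A) (\<lambda>_. lborel).
            K (k + card (insert j A)) (c + (\<Sum>i\<in>insert j A. t i)))
        = (LINT t|PiM A (\<lambda>_. lborel). LINT u|lborel. indicator (PiE (insert j A) (\<lambda>i. {0..x i})) (t(j := u)) *\<^sub>R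
            K (Suc ?n) (c + (\<Sum>i\<in>insert j A. (t(j := u)) i)))"
      unfolding set_lebesgue_integral_def
      using integrable[of "insert j A" c "Suc ?n"] insert
      by (subst product_integral_insert) (auto simp: set_integrable_def)
    also have "\<dots> = (LINT t|PiM A (\<lambda>_. lborel). indicator (PiE A (\<lambda>i. {0..x i})) t *\<^sub>R K ?n (c + (\<Sum>i\<in>A. t i))
          - indicator (PiE A (\<lambda>i. {0..x i})) t *\<^sub>R K ?n (c + x j + (\<Sum>i\<in>A. t i)))"
      by (rule Bochner_Integration.integral_cong[OF refl inner])
    also have "\<dots> = (LINT t : PiE A (\<lambda>i. {0..x i}) | PiM A (\<lambda>_. lborel). K ?n (c + (\<Sum>i\<in>A. t i)))
        - (LINT t : PiE A (\<lambda>i. {0..x i}) | PiM A (\<lambda>_. lborel). K ?n (c + x j + (\<Sum>i\<in>A. t i)))"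
      unfolding set_lebesgue_integral_def
      using integrable[OF insert.hyps(1) xA, of c ?n] integrable[OF insert.hyps(1) xA, of "c + x j" ?n] insert.prems xj
      by (intro Bochner_Integration.integral_diff) (auto simp: set_integrable_def)
    also have "\<dots> = (\<Sum>I\<in>Pow A. (-1) ^ card I * (K k (c + sum x I) - K k (c + x j + sum x I)))"
      using insert.IH[of c] insert.IH[of "c + x j"] insert.prems xj xA
      by (simp add: sum_subtractf right_diff_distrib)
    also have "\<dots> = (\<Sum>I\<in>Pow A. (-1) ^ card I * (K k (c + sum x I) - K k (c + sum x (insert j I))))"
    proof (rule sum.cong)
      fix I assume "I \<in> Pow A"
      then have "finite I" "j \<notin> I" using insert.hyps by (auto intro: finite_subset)
      then show "(-1) ^ card I * (K k (c + sum x I) - K k (c + x j + sum x I))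
          = (-1) ^ card I * (K k (c + sum x I) - K k (c + sum x (insert j I)))"
        by (simp add: add.assoc)
    qed simp
    also have "\<dots> = (\<Sum>I\<in>Pow (insert j A). (-1) ^ card I * K k (c + sum x I))"
      by (rule sum_Pow_insert_alternating[OF insert.hyps, symmetric])
    finally show ?case .
  qed
qed

text \<open>Up to the sign \<open>(-1) ^ n\<close>, the \<open>n\<close>-th derivative of \<open>t ln t\<close>.\<close>

definition xlnx_derivs :: "nat \<Rightarrow> real \<Rightarrow> real" where
  "xlnx_derivs n t = (if n = 0 then t * ln t else if n = 1 then - (ln t + 1) else fact (n - 2) / t ^ (n - 1))"

lemma has_derivative_xlnx_derivs:
  assumes t: "0 < t"
  shows "(xlnx_derivs n has_real_derivative - xlnx_derivs (Suc n) t) (at t)"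
proof -
  consider "n = 0" | "n = 1" | m where "n = Suc (Suc m)"
    by (metis One_nat_def not0_implies_Suc)
  then show ?thesis
  proof cases
    case 1
    show ?thesis unfolding xlnx_derivs_def[abs_def] 1 using t
      by (auto intro!: derivative_eq_intros)
  next
    case 2
    show ?thesis unfolding xlnx_derivs_def[abs_def] 2 using t
      by (auto intro!: derivative_eq_intros)
  next
    case 3
    have "((\<lambda>t. fact m / t ^ Suc m) has_real_derivative - (fact (Suc m) / t ^ Suc (Suc m))) (at t)"
      using t by (intro DERIV_cong[OF DERIV_divide[OF DERIV_const DERIV_pow]]) (auto simp: field_simps)
    then show ?thesis unfolding xlnx_derivs_def[abs_def] 3 by simp
  qed
qed

lemma borel_measurable_xlnx_derivs: "xlnx_derivs n \<in> borel_measurable borel"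
  unfolding xlnx_derivs_def[abs_def] by measurable

text \<open>Apply \<open>integral_box_sum\<close> to \<open>xlnx_derivs\<close> from order 0 to
  order \<open>card J\<close> with shift \<open>1 / Suc m\<close>. The integrands increase as the
  shift decreases to 0, so monotone convergence passes to the limit.\<close>

lemma integral_box_inverse_power_sum:
  fixes x :: "'i \<Rightarrow> real"
  assumes J: "finite J" "2 \<le> card J" and x: "\<And>i. i \<in> J \<Longrightarrow> 0 < x i"
  shows "set_integrable (PiM J (\<lambda>_. lborel)) (PiE J (\<lambda>i. {0..x i})) (\<lambda>t. 1 / (\<Sum>i\<in>J. t i) ^ (card J - 1))"
    and "(\<Sum>I\<in>Pow J. (-1) ^ card I * (sum x I * ln (sum x I)))
      = fact (card J - 2) * (LINT t : PiE J (\<lambda>i. {0..x i}) | PiM J (\<lambda>_. lborel). 1 / (\<Sum>i\<in>J. t i) ^ (card J - 1))"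
proof -
  interpret product_sigma_finite "\<lambda>_. lborel :: real measure" ..
  let ?M = "PiM J (\<lambda>_. lborel :: real measure)" and ?B = "PiE J (\<lambda>i. {0..x i})"
  define d where "d = card J"
  have d: "2 \<le> d" "J \<noteq> {}" using J by (auto simp: d_def)
  define h where "h m t = indicat_real ?B t *\<^sub>R xlnx_derivs d (1 / real (Suc m) + (\<Sum>i\<in>J. t i))" for m t
  define u where "u t = indicat_real ?B t *\<^sub>R (fact (d - 2) * (1 / (\<Sum>i\<in>J. t i) ^ (d - 1)))" for t
  have K: "xlnx_derivs d t = fact (d - 2) / t ^ (d - 1)" for t
    using d by (simp add: xlnx_derivs_def)
  note box = integral_box_sum[of J x _ xlnx_derivs, OF J(1) less_imp_le[OF x] _ has_derivative_xlnx_derivs borel_measurable_xlnx_derivs]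
  have h_int: "integrable ?M (h m)" for m
    using box(1)[of "1 / real (Suc m)" d] unfolding h_def[abs_def] set_integrable_def by simp
  have h_val: "integral\<^sup>L ?M (h m) = (\<Sum>I\<in>Pow J. (-1) ^ card I * xlnx_derivs 0 (1 / real (Suc m) + sum x I))" for m
    using box(2)[of "1 / real (Suc m)" 0] unfolding h_def[abs_def] set_lebesgue_integral_def by (simp add: d_def)
  \<comment> \<open>The origin is the only point of the box where the coordinate sum vanishes. The
    shifted integrands diverge there, so it is discarded as a null set.\<close>
  have "emeasure ?M (PiE J (\<lambda>_. {0})) = 0"
    using J d by (subst emeasure_PiM) auto
  then have null: "PiE J (\<lambda>_. {0}) \<in> null_sets ?M"
    using J by (intro null_setsI sets_PiM_I_finite) auto
  have pos: "AE t in ?M. t \<in> ?B \<longrightarrow> 0 < (\<Sum>i\<in>J. t i)"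
    using AE_not_in[OF null]
  proof eventually_elim
    case (elim t)
    show ?case
    proof
      assume t: "t \<in> ?B"
      then have nn: "\<And>i. i \<in> J \<Longrightarrow> 0 \<le> t i" by (auto simp: PiE_iff)
      obtain i where i: "i \<in> J" "t i \<noteq> 0" using elim t unfolding PiE_iff by blast
      have "0 < t i" using i nn[of i] by simp
      then show "0 < (\<Sum>i\<in>J. t i)" using J(1) i(1) nn by (intro sum_pos2)
    qed
  qed
  have mono: "AE t in ?M. mono (\<lambda>m. h m t)"
    using pos
  proof eventually_elim
    case (elim t)
    show ?case
    proof (rule monoI)
      fix m n :: nat assume mn: "m \<le> n"
      show "h m t \<le> h n t"
      proof (cases "t \<in> ?B")
        case True
        with elim have "0 < (\<Sum>i\<in>J. t i)" by simp
        moreover have "1 / real (Suc n) \<le> 1 / real (Suc m)" using mn by (simp add: frac_le)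
        ultimately show ?thesis using True
          by (auto simp: h_def K intro!: divide_left_mono power_mono mult_pos_pos zero_less_power add_pos_pos)
      qed (simp add: h_def)
    qed
  qed
  have inv: "(\<lambda>m. 1 / real (Suc m)) \<longlonglongrightarrow> 0"
    using LIMSEQ_inverse_real_of_nat by (simp add: inverse_eq_divide)
  have lim: "AE t in ?M. (\<lambda>m. h m t) \<longlonglongrightarrow> u t"
    using pos
  proof eventually_elim
    case (elim t)
    show ?case
    proof (cases "t \<in> ?B")
      case True
      with elim have S: "0 < (\<Sum>i\<in>J. t i)" by simp
      have "(\<lambda>m. fact (d - 2) / (1 / real (Suc m) + (\<Sum>i\<in>J. t i)) ^ (d - 1))
          \<longlonglongrightarrow> fact (d - 2) / (0 + (\<Sum>i\<in>J. t i)) ^ (d - 1)"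
        using S by (intro tendsto_intros inv) auto
      then show ?thesis using True by (simp add: h_def u_def K)
    qed (simp add: h_def u_def)
  qed
  \<comment> \<open>For the empty subset, whose term is evaluated at the shift alone; all other
    terms are continuous at shift 0.\<close>
  have xlnx: "((\<lambda>t::real. t * ln t) \<longlongrightarrow> 0) (at_right 0)" by real_asymp
  have "(\<lambda>m. xlnx_derivs 0 (1 / real (Suc m) + sum x I)) \<longlonglongrightarrow> sum x I * ln (sum x I)" if I: "I \<in> Pow J" for I
  proof (cases "I = {}")
    case True
    have "filterlim (\<lambda>m. 1 / real (Suc m)) (at_right 0) sequentially"
      using inv by (intro filterlim_atI tendsto_imp_filterlim_at_right) auto
    from filterlim_compose[OF xlnx this] True show ?thesis by (simp add: xlnx_derivs_def)
  next
    case False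
    have "0 < sum x I" using False I x J by (intro sum_pos) (auto intro: finite_subset)
    then have "(\<lambda>m. (1 / real (Suc m) + sum x I) * ln (1 / real (Suc m) + sum x I))
        \<longlonglongrightarrow> (0 + sum x I) * ln (0 + sum x I)"
      by (intro tendsto_intros inv) auto
    then show ?thesis by (simp add: xlnx_derivs_def)
  qed
  then have ilim: "(\<lambda>m. integral\<^sup>L ?M (h m)) \<longlonglongrightarrow> (\<Sum>I\<in>Pow J. (-1) ^ card I * (sum x I * ln (sum x I)))"
    unfolding h_val by (intro tendsto_intros)
  have [measurable]: "?B \<in> sets ?M" using J by (intro sets_PiM_I_finite) auto
  have "u \<in> borel_measurable ?M" unfolding u_def[abs_def] by measurable
  \<comment> \<open>The integrals converge by \<open>ilim\<close>, so integrability near the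
    singularity comes together with the value.\<close>
  from integrable_monotone_convergence[OF h_int mono lim ilim this]
    integral_monotone_convergence[OF h_int mono lim ilim this]
  have int: "set_integrable ?M ?B (\<lambda>t. fact (d - 2) * (1 / (\<Sum>i\<in>J. t i) ^ (d - 1)))"
    and val: "(LINT t:?B|?M. fact (d - 2) * (1 / (\<Sum>i\<in>J. t i) ^ (d - 1))) = (\<Sum>I\<in>Pow J. (-1) ^ card I * (sum x I * ln (sum x I)))"
    unfolding set_integrable_def set_lebesgue_integral_def u_def[abs_def] by simp_all
  show "set_integrable ?M ?B (\<lambda>t. 1 / (\<Sum>i\<in>J. t i) ^ (card J - 1))"
    using set_integrable_mult_right[of "1 / fact (d - 2)", OF int] by (simp add: d_def)
  show "(\<Sum>I\<in>Pow J. (-1) ^ card I * (sum x I * ln (sum x I)))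
      = fact (card J - 2) * (LINT t:?B|?M. 1 / (\<Sum>i\<in>J. t i) ^ (card J - 1))"
    using val unfolding set_integral_mult_right by (simp add: d_def)
qed

section \<open>Joint survival probability\<close>

text \<open>The mean of a non-decreasing function over \<open>{a..b}\<close> lies between its
  endpoint values; \<open>b < 1\<close> since \<open>\<phi>'\<close> is monotone on the open
  interval.\<close>

lemma gen_deriv_slope:
  assumes D: "gen_deriv \<phi> \<phi>'" and ab: "0 < a" "a \<le> b" "b < 1"
  shows "(b - a) * \<phi>' a \<le> enn2real (\<phi> b) - enn2real (\<phi> a)"
    and "enn2real (\<phi> b) - enn2real (\<phi> a) \<le> (b - a) * \<phi>' b"
proof -
  have mono: "mono_on {0<..<1} \<phi>'" and int: "set_integrable lborel {a..b} \<phi>'"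
    and eq: "(LINT t:{a..b}|lborel. \<phi>' t) = enn2real (\<phi> b) - enn2real (\<phi> a)"
    using D ab unfolding gen_deriv_def by auto
  have const: "(LINT t:{a..b}|lborel. c) = (b - a) * c" "set_integrable lborel {a..b} (\<lambda>_. c)" for c :: real
    using ab by (auto simp: set_integral_const set_integrable_def)
  have "(LINT t:{a..b}|lborel. \<phi>' a) \<le> (LINT t:{a..b}|lborel. \<phi>' t)"
    using ab by (intro set_integral_mono const int) (auto intro!: mono_onD[OF mono])
  then show "(b - a) * \<phi>' a \<le> enn2real (\<phi> b) - enn2real (\<phi> a)" by (simp add: const eq)
  have "(LINT t:{a..b}|lborel. \<phi>' t) \<le> (LINT t:{a..b}|lborel. \<phi>' b)"
    using ab by (intro set_integral_mono const int) (auto intro!: mono_onD[OF mono])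
  then show "enn2real (\<phi> b) - enn2real (\<phi> a) \<le> (b - a) * \<phi>' b" by (simp add: const eq)
qed

section \<open>Transfer to Archimedean generators\<close>

locale de_haan_arch_generator =
  fixes \<phi> :: "real \<Rightarrow> ennreal" and \<phi>' :: "real \<Rightarrow> real"
  assumes generator: "arch_generator \<phi>"
    and gen_deriv: "gen_deriv \<phi> \<phi>'"
    and L_fun_pos: "\<forall>s\<in>{0<..<1}. L_fun \<phi> \<phi>' s > 0"
    and L_fun_slow: "slowly_varying_at_0 (L_fun \<phi> \<phi>')"

text \<open>The reflection of \<open>s\<close> to \<open>1 - s\<close> swaps the endpoints and the
  sign of the derivative, so the two bounds of \<open>gen_deriv_slope\<close> exchange their
  roles.\<close>

sublocale de_haan_arch_generator \<subseteq>
  de_haan_generator "\<lambda>s. enn2real (\<phi> (1 - s))" "\<lambda>s. - \<phi>' (1 - s)" "L_fun \<phi> \<phi>'"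
proof
  fix s t :: real assume st: "0 < s" "s \<le> t" "t < 1"
  then have "(1 - s - (1 - t)) * \<phi>' (1 - t) \<le> enn2real (\<phi> (1 - s)) - enn2real (\<phi> (1 - t))"
    "enn2real (\<phi> (1 - s)) - enn2real (\<phi> (1 - t)) \<le> (1 - s - (1 - t)) * \<phi>' (1 - s)"
    using gen_deriv_slope[OF gen_deriv, of "1 - t" "1 - s"] by auto
  then show "(t - s) * - \<phi>' (1 - s) \<le> enn2real (\<phi> (1 - t)) - enn2real (\<phi> (1 - s))"
    "enn2real (\<phi> (1 - t)) - enn2real (\<phi> (1 - s)) \<le> (t - s) * - \<phi>' (1 - t)"
    by (auto simp: algebra_simps)
qed (use L_fun_pos L_fun_slow in \<open>auto simp: L_fun_def slowly_varying_at_0_def\<close>)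

context de_haan_arch_generator
begin

lemma g_eq: "g = g_fun \<phi> \<phi>'"
  by (simp add: fun_eq_iff g_def F_def g_fun_def mult.commute)

lemma slowly_varying_g_fun: "slowly_varying_at_0 (g_fun \<phi> \<phi>')"
  unfolding slowly_varying_at_0_def
proof (intro conjI allI impI)
  obtain \<delta> where \<delta>: "0 < \<delta>" "L_fun \<phi> \<phi>' \<in> borel_measurable (restrict_space borel {0<..<\<delta>})"
    using L_fun_slow unfolding slowly_varying_at_0_def by auto
  \<comment> \<open>\<open>L_fun\<close> is measurable below \<open>\<delta>\<close>, while
    continuity of the generator and \<open>g_pos\<close> hold below 1.\<close>
  define \<epsilon> where "\<epsilon> = min \<delta> 1"
  have [measurable]: "L_fun \<phi> \<phi>' \<in> borel_measurable (restrict_space borel {0<..<\<epsilon>})"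
    by (rule measurable_restrict_mono[OF \<delta>(2)]) (auto simp: \<epsilon>_def)
  have [measurable]: "(\<lambda>s. enn2real (\<phi> (1 - s))) \<in> borel_measurable (restrict_space borel {0<..<\<epsilon>})"
    by (intro borel_measurable_continuous_on_restrict continuous_on_subset[OF continuous])
      (auto simp: \<epsilon>_def)
  have [measurable]: "(\<lambda>s. s) \<in> borel_measurable (restrict_space borel {0<..<\<epsilon>})"
    by (rule measurable_restrict_space1) simp
  have "(\<lambda>s. g_fun \<phi> \<phi>' s) \<in> borel_measurable (restrict_space borel {0<..<\<epsilon>})"
    unfolding g_fun_def by measurable
  then show "\<exists>\<delta>>0. (\<forall>s\<in>{0<..<\<delta>}. 0 < g_fun \<phi> \<phi>' s) \<and>
      g_fun \<phi> \<phi>' \<in> borel_measurable (restrict_space borel {0<..<\<delta>})"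
    using \<delta>(1) g_pos unfolding g_eq by (intro exI[of _ \<epsilon>]) (auto simp: \<epsilon>_def)
qed (use g_slow in \<open>simp add: g_eq\<close>)

lemma \<phi>_1: "\<phi> 1 = 0"
  using generator by (simp add: arch_generator_def)

text \<open>Where \<open>\<phi>\<close> were infinite, \<^const>\<open>enn2real\<close> would make it vanish, but \<open>s \<mapsto> enn2real (\<phi> (1 - s))\<close>
  is strictly increasing.\<close>

lemma \<phi>_eq_ennreal:
  assumes "0 \<le> s" "s < 1"
  shows "\<phi> (1 - s) = ennreal (enn2real (\<phi> (1 - s)))"
proof (cases "s = 0")
  case False
  then have "enn2real (\<phi> (1 - s)) \<noteq> 0" using pos[of s] assms by auto
  then have "\<phi> (1 - s) \<noteq> top" by auto
  then show ?thesis by (simp add: less_top)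
qed (simp add: \<phi>_1)

text \<open>The infimum is attained at \<open>1 - v\<close> because the generator is strictly
  decreasing wherever it is known to be finite.\<close>

lemma gen_inverse_\<phi>:
  assumes v: "0 \<le> v" "v < 1"
  shows "gen_inverse \<phi> (\<phi> (1 - v)) = 1 - v"
  unfolding gen_inverse_def
proof (rule cInf_eq_minimum)
  fix t assume "t \<in> {t \<in> {0..1}. \<phi> t \<le> \<phi> (1 - v)}"
  then have t: "0 \<le> t" "t \<le> 1" "\<phi> t \<le> \<phi> (1 - v)" by auto
  show "1 - v \<le> t"
  proof (rule ccontr)
    assume less: "\<not> 1 - v \<le> t"
    \<comment> \<open>\<open>1 - w\<close> is the midpoint of \<open>t\<close> and
      \<open>1 - v\<close>. It is positive even if \<open>t = 0\<close>, where \<open>\<phi>\<close>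
      may be infinite, so strict monotonicity applies.\<close>
    define w where "w = 1 - (t + (1 - v)) / 2"
    have w: "v < w" "w < 1" "t \<le> 1 - w" using less t v by (auto simp: w_def field_simps)
    have "\<phi> (1 - w) \<le> \<phi> t"
      using generator w t v unfolding arch_generator_def by (auto elim!: monotone_onD)
    also note t(3)
    finally have "enn2real (\<phi> (1 - w)) \<le> enn2real (\<phi> (1 - v))"
      by (rule enn2real_mono) (subst \<phi>_eq_ennreal[OF v], simp)
    moreover have "enn2real (\<phi> (1 - v)) < enn2real (\<phi> (1 - w))"
      using strict_mono[of v w] pos[of w] v w \<phi>_1 by (cases "v = 0") auto
    ultimately show False by simp
  qed
qed (use v in auto)

section \<open>Survival probabilities through the copula\<close>

lemma arch_copula_restrict:
  assumes "I \<subseteq> {1..d}"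
  shows "arch_copula d \<phi> (\<lambda>i. if i \<in> I then a i else 1) = gen_inverse \<phi> (\<Sum>i\<in>I. \<phi> (a i))"
proof -
  have "(\<Sum>i=1..d. \<phi> (if i \<in> I then a i else 1)) = (\<Sum>i=1..d. if i \<in> I then \<phi> (a i) else 0)"
    by (intro sum.cong) (auto simp: \<phi>_1)
  also have "\<dots> = (\<Sum>i\<in>{1..d} \<inter> I. \<phi> (a i))" by (simp add: sum.If_cases)
  also have "{1..d} \<inter> I = I" using assms by auto
  finally show ?thesis by (simp add: arch_copula_def)
qed

text \<open>Inclusion-exclusion for the events \<open>U i < a i\<close>. Strict inequalities may be
  relaxed because the margins have no atoms, and unconstrained coordinates get the bound 1 because
  \<open>U i\<close> is almost surely at most 1.\<close>

lemma survival_inclusion_exclusion: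
  assumes M: "prob_space M" and U: "has_copula_cdf M d U (arch_copula d \<phi>)"
    and a: "\<And>i. i \<in> {1..d} \<Longrightarrow> 0 < a i \<and> a i < 1"
  shows "measure M {\<omega> \<in> space M. \<forall>i\<in>{1..d}. a i \<le> U i \<omega>}
    = (\<Sum>I\<in>Pow {1..d}. (-1) ^ card I * arch_copula d \<phi> (\<lambda>i. if i \<in> I then a i else 1))"
proof -
  interpret prob_space M by fact
  have meas[measurable]: "\<And>i. i \<in> {1..d} \<Longrightarrow> U i \<in> borel_measurable M"
    using U by (auto simp: has_copula_cdf_def)
  have cdf: "measure M {\<omega> \<in> space M. \<forall>i\<in>{1..d}. U i \<omega> \<le> u i} = arch_copula d \<phi> u"
      if "\<forall>i\<in>{1..d}. u i \<in> {0..1}" for u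
    using U that by (auto simp: has_copula_cdf_def joint_cdf_def)
  have "{\<omega> \<in> space M. \<forall>i\<in>{1..d}. U i \<omega> \<le> 1} \<in> sets M" by measurable
  moreover have "prob {\<omega> \<in> space M. \<forall>i\<in>{1..d}. U i \<omega> \<le> 1} = 1"
    using cdf[of "\<lambda>_. 1"] gen_inverse_\<phi>[of 0] by (simp add: arch_copula_def \<phi>_1)
  ultimately have le1: "AE \<omega> in M. \<forall>i\<in>{1..d}. U i \<omega> \<le> 1"
    by (rule iffD1[OF prob_Collect_eq_1])
  have marginal: "prob {\<omega> \<in> space M. U i \<omega> \<le> u} = u" if i: "i \<in> {1..d}" and u: "0 < u" "u \<le> 1" for i u
  proof -
    have "prob {\<omega> \<in> space M. U i \<omega> \<le> u} = prob {\<omega> \<in> space M. \<forall>j\<in>{1..d}. U j \<omega> \<le> (if j \<in> {i} then u else 1)}"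
    proof (rule finite_measure_eq_AE)
      show "AE \<omega> in M. \<omega> \<in> {\<omega> \<in> space M. U i \<omega> \<le> u} \<longleftrightarrow>
          \<omega> \<in> {\<omega> \<in> space M. \<forall>j\<in>{1..d}. U j \<omega> \<le> (if j \<in> {i} then u else 1)}"
        using le1 by eventually_elim (use i in auto)
    qed (use i in measurable)
    also have "\<dots> = arch_copula d \<phi> (\<lambda>j. if j \<in> {i} then u else 1)"
      using u by (intro cdf) auto
    also have "\<dots> = u"
      using arch_copula_restrict[of "{i}" d "\<lambda>_. u"] gen_inverse_\<phi>[of "1 - u"] i u by simp
    finally show ?thesis .
  qed
  have atom: "AE \<omega> in M. U i \<omega> \<noteq> a i" if i: "i \<in> {1..d}" for i
  proof -
    note meas[OF i, measurable]
    have "prob {\<omega> \<in> space M. U i \<omega> = a i} \<le> e" if e: "0 < e" for e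
    proof -
      \<comment> \<open>Within \<open>e\<close> of \<open>a i\<close>, yet positive as
        \<open>marginal\<close> requires.\<close>
      define b where "b = max (a i / 2) (a i - e)"
      have b: "0 < b" "b < a i" "a i - b \<le> e" "a i \<le> 1" using a[OF i] e by (auto simp: b_def)
      have "{\<omega> \<in> space M. U i \<omega> = a i} \<subseteq> {\<omega> \<in> space M. U i \<omega> \<le> a i} - {\<omega> \<in> space M. U i \<omega> \<le> b}"
        using b by auto
      then have "prob {\<omega> \<in> space M. U i \<omega> = a i}
          \<le> prob ({\<omega> \<in> space M. U i \<omega> \<le> a i} - {\<omega> \<in> space M. U i \<omega> \<le> b})"
        by (rule finite_measure_mono) measurable
      also have "\<dots> = prob {\<omega> \<in> space M. U i \<omega> \<le> a i} - prob {\<omega> \<in> space M. U i \<omega> \<le> b}"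
        using b by (intro finite_measure_Diff) auto
      also have "\<dots> \<le> e" using b marginal[OF i, of "a i"] marginal[OF i, of b] by simp
      finally show ?thesis .
    qed
    then have "prob {\<omega> \<in> space M. U i \<omega> = a i} \<le> 0" by (rule field_le_epsilon[where y = 0, simplified])
    then have "prob {\<omega> \<in> space M. U i \<omega> = a i} = 0" by (simp add: measure_le_0_iff)
    moreover have "{\<omega> \<in> space M. U i \<omega> = a i} \<in> sets M" by measurable
    ultimately show ?thesis using prob_Collect_eq_0[of "\<lambda>\<omega>. U i \<omega> = a i"] by simp
  qed
  then have atoms: "AE \<omega> in M. \<forall>i\<in>{1..d}. U i \<omega> \<noteq> a i" by (simp add: AE_finite_all)
  define A where "A i = {\<omega> \<in> space M. U i \<omega> < a i}" for i
  have A: "A i \<in> sets M" if "i \<in> {1..d}" for i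
    using meas[OF that] unfolding A_def by measurable
  have "{\<omega> \<in> space M. \<forall>i\<in>{1..d}. a i \<le> U i \<omega>} = {\<omega> \<in> space M. \<forall>i\<in>{1..d}. \<omega> \<notin> A i}"
    by (auto simp: A_def not_less)
  also have "prob \<dots> = (\<Sum>I\<in>Pow {1..d}. (-1) ^ card I * prob {\<omega> \<in> space M. \<forall>i\<in>I. \<omega> \<in> A i})"
    using A by (intro inclusion_exclusion_compl) auto
  also have "\<dots> = (\<Sum>I\<in>Pow {1..d}. (-1) ^ card I * arch_copula d \<phi> (\<lambda>i. if i \<in> I then a i else 1))"
  proof (intro sum.cong refl arg_cong2[where f = "(*)"])
    fix I assume I: "I \<in> Pow {1..d}"
    then have fin: "finite I" by (auto intro: finite_subset)
    have "prob {\<omega> \<in> space M. \<forall>i\<in>I. \<omega> \<in> A i}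
        = prob {\<omega> \<in> space M. \<forall>i\<in>{1..d}. U i \<omega> \<le> (if i \<in> I then a i else 1)}"
    proof (rule finite_measure_eq_AE)
      show "AE \<omega> in M. \<omega> \<in> {\<omega> \<in> space M. \<forall>i\<in>I. \<omega> \<in> A i} \<longleftrightarrow>
          \<omega> \<in> {\<omega> \<in> space M. \<forall>i\<in>{1..d}. U i \<omega> \<le> (if i \<in> I then a i else 1)}"
        using le1 atoms by eventually_elim (use I in \<open>force simp: A_def order_less_le\<close>)
      show "{\<omega> \<in> space M. \<forall>i\<in>I. \<omega> \<in> A i} \<in> sets M"
        using I A fin by (intro sets.sets_Collect_finite_All) (auto simp: Int_def[symmetric])
    qed measurable
    also have "\<dots> = arch_copula d \<phi> (\<lambda>i. if i \<in> I then a i else 1)"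
      using a by (intro cdf) (auto simp: less_imp_le)
    finally show "prob {\<omega> \<in> space M. \<forall>i\<in>I. \<omega> \<in> A i} = \<dots>" .
  qed
  finally show ?thesis .
qed

text \<open>The copula value is \<open>1 - v\<close> for the solution \<open>v\<close> from
  \<open>ex_inverse_sum\<close>, so \<open>v / s\<close> is an admissible \<open>y s\<close> in
  \<open>inverse_sum_tendsto\<close>.\<close>

lemma arch_copula_expansion:
  assumes I: "I \<subseteq> {1..d}" "I \<noteq> {}" and x: "\<And>i. i \<in> I \<Longrightarrow> 0 < x i"
  shows "((\<lambda>s. (sum x I - (1 - arch_copula d \<phi> (\<lambda>i. if i \<in> I then 1 - s * x i else 1)) / s) / g s)
    \<longlongrightarrow> sum x I * ln (sum x I) - (\<Sum>i\<in>I. x i * ln (x i))) (at_right 0)"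
proof -
  obtain j where j: "j \<in> I" using I by auto
  have fin: "finite I" using I(1) by (rule finite_subset) simp
  show ?thesis
  proof (rule inverse_sum_tendsto[of I j x, OF fin j x])
    show "\<forall>\<^sub>F s in at_right 0.
        x j \<le> (1 - arch_copula d \<phi> (\<lambda>i. if i \<in> I then 1 - s * x i else 1)) / s \<and>
        (1 - arch_copula d \<phi> (\<lambda>i. if i \<in> I then 1 - s * x i else 1)) / s \<le> sum x I \<and>
        enn2real (\<phi> (1 - s * ((1 - arch_copula d \<phi> (\<lambda>i. if i \<in> I then 1 - s * x i else 1)) / s)))
          = (\<Sum>i\<in>I. enn2real (\<phi> (1 - s * x i)))"
      using eventually_scaled_small[of "sum x I"]
    proof eventually_elim
      case (elim s)
      obtain v where v: "s * x j \<le> v" "v \<le> s * sum x I"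
        "enn2real (\<phi> (1 - v)) = (\<Sum>i\<in>I. enn2real (\<phi> (1 - s * x i)))"
        using ex_inverse_sum[of I j x s, OF fin j x] elim by auto
      have v01: "0 \<le> v" "v < 1"
        using v elim mult_pos_pos[of s "x j"] x[OF j] by linarith+
      have "\<phi> (1 - s * x i) = ennreal (enn2real (\<phi> (1 - s * x i)))" if "i \<in> I" for i
      proof (rule \<phi>_eq_ennreal)
        show "0 \<le> s * x i" using elim x[OF that] by simp
        have "s * x i \<le> s * sum x I"
          using elim member_le_sum_pos[of I i x, OF fin that x] by simp
        then show "s * x i < 1" using elim by linarith
      qed
      then have "(\<Sum>i\<in>I. \<phi> (1 - s * x i)) = (\<Sum>i\<in>I. ennreal (enn2real (\<phi> (1 - s * x i))))"
        by (intro sum.cong) auto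
      also have "\<dots> = ennreal (enn2real (\<phi> (1 - v)))" unfolding v(3) by (simp add: sum_ennreal)
      also have "\<dots> = \<phi> (1 - v)" using \<phi>_eq_ennreal[OF v01] by simp
      finally have C: "arch_copula d \<phi> (\<lambda>i. if i \<in> I then 1 - s * x i else 1) = 1 - v"
        using arch_copula_restrict[OF I(1), of "\<lambda>i. 1 - s * x i"] gen_inverse_\<phi>[OF v01] by simp
      show ?case unfolding C using v(1,2) elim by (simp add: v(3) divide_le_eq le_divide_eq mult.commute)
    qed
  qed
qed

text \<open>Constants and sums additive over \<open>I\<close> vanish in the alternating sum. Hence
  \<open>C I s\<close> may be completed to \<open>sum x I - (1 - C I s) / s\<close>, which converges
  after division by \<open>g s\<close>; in the limit the terms \<open>x i * ln (x i)\<close>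
  disappear for the same reason.\<close>

lemma survival_tendsto:
  assumes d: "2 \<le> d" and M: "prob_space M" and U: "has_copula_cdf M d U (arch_copula d \<phi>)"
    and x: "\<And>i. i \<in> {1..d} \<Longrightarrow> 0 < x i"
  shows "((\<lambda>s. 1 / (s * g s) * measure M {\<omega> \<in> space M. \<forall>i\<in>{1..d}. U i \<omega> \<ge> 1 - s * x i})
    \<longlongrightarrow> (\<Sum>I\<in>Pow {1..d}. (-1) ^ card I * (sum x I * ln (sum x I)))) (at_right 0)"
proof -
  let ?P = "Pow {1..d}"
  define C where "C I s = arch_copula d \<phi> (\<lambda>i. if i \<in> I then 1 - s * x i else 1)" for I s
  have C_empty: "C {} s = 1" for s
    using arch_copula_restrict[of "{}" d] gen_inverse_\<phi>[of 0] by (simp add: C_def \<phi>_1)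
  have "((\<lambda>s. (sum x I - (1 - C I s) / s) / g s) \<longlongrightarrow> sum x I * ln (sum x I) - (\<Sum>i\<in>I. x i * ln (x i))) (at_right 0)"
    if I: "I \<in> ?P" for I
  proof (cases "I = {}")
    case False
    with I x show ?thesis unfolding C_def by (intro arch_copula_expansion) auto
  qed (simp add: C_empty)
  then have "((\<lambda>s. \<Sum>I\<in>?P. (-1) ^ card I * ((sum x I - (1 - C I s) / s) / g s))
      \<longlongrightarrow> (\<Sum>I\<in>?P. (-1) ^ card I * (sum x I * ln (sum x I) - (\<Sum>i\<in>I. x i * ln (x i))))) (at_right 0)"
    by (intro tendsto_intros)
  moreover have "(\<Sum>I\<in>?P. (-1) ^ card I * (sum x I * ln (sum x I) - (\<Sum>i\<in>I. x i * ln (x i))))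
      = (\<Sum>I\<in>?P. (-1) ^ card I * (sum x I * ln (sum x I)))"
    using sum_Pow_alternating_sum[of "{1..d}" "\<lambda>i. x i * ln (x i)"] d
    by (simp add: right_diff_distrib sum_subtractf)
  moreover have "\<forall>\<^sub>F s in at_right 0. (\<Sum>I\<in>?P. (-1) ^ card I * ((sum x I - (1 - C I s) / s) / g s))
      = 1 / (s * g s) * measure M {\<omega> \<in> space M. \<forall>i\<in>{1..d}. U i \<omega> \<ge> 1 - s * x i}"
    using eventually_scaled_small[of "sum x {1..d}"]
  proof eventually_elim
    case (elim s)
    have small: "0 < 1 - s * x i \<and> 1 - s * x i < 1" if "i \<in> {1..d}" for i
    proof -
      have "s * x i \<le> s * sum x {1..d}"
        using elim member_le_sum_pos[of "{1..d}" i x, OF _ that x] by simp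
      moreover have "0 < s * x i" using elim x[OF that] by simp
      ultimately show ?thesis using elim by linarith
    qed
    \<comment> \<open>\<open>e\<close>, \<open>S\<close> and \<open>c\<close> stand for the sign,
      \<open>sum x I\<close> and \<open>C I s\<close>.\<close>
    have summand: "e * ((S - (1 - c) / s) / g s) = (e * S - e * 1 / s + e * c / s) / g s" for e S c
    proof -
      have "e * (S - (1 - c) / s) = e * S - e * 1 / s + e * c / s"
        by (simp add: diff_divide_distrib right_diff_distrib)
      then show ?thesis by (simp only: times_divide_eq_right)
    qed
    have "(\<Sum>I\<in>?P. (-1) ^ card I * ((sum x I - (1 - C I s) / s) / g s))
        = ((\<Sum>I\<in>?P. (-1) ^ card I * sum x I) - (\<Sum>I\<in>?P. (-1) ^ card I * 1) / s
            + (\<Sum>I\<in>?P. (-1) ^ card I * C I s) / s) / g s"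
      by (simp only: summand sum_divide_distrib[symmetric] sum_subtractf sum.distrib)
    also have "\<dots> = (\<Sum>I\<in>?P. (-1) ^ card I * C I s) / s / g s"
      using sum_Pow_alternating_sum[of "{1..d}" x] sum_Pow_alternating[of "{1..d}"] d by simp
    also have "\<dots> = 1 / (s * g s) * measure M {\<omega> \<in> space M. \<forall>i\<in>{1..d}. U i \<omega> \<ge> 1 - s * x i}"
      using survival_inclusion_exclusion[of M d U "\<lambda>i. 1 - s * x i", OF M U small] by (simp add: C_def)
    finally show ?case .
  qed
  ultimately show ?thesis by (auto intro: Lim_transform_eventually)
qed

end

theorem theorem4p6:
  fixes d :: nat and \<phi> :: "real \<Rightarrow> ennreal" and \<phi>' :: "real \<Rightarrow> real"
    and M :: "'a measure" and U :: "nat \<Rightarrow> 'a \<Rightarrow> real"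
  assumes "d \<ge> 2"
    and "arch_generator \<phi>"
    and "is_copula d (arch_copula d \<phi>)"
    and "prob_space M"
    and "has_copula_cdf M d U (arch_copula d \<phi>)"
    and "gen_deriv \<phi> \<phi>'"
    and "\<phi>' 1 = 0"
    and "\<forall>s\<in>{0<..<1}. L_fun \<phi> \<phi>' s > 0"
    and "slowly_varying_at_0 (L_fun \<phi> \<phi>')"
  shows "(\<forall>s\<in>{0<..<1}. g_fun \<phi> \<phi>' s > 0) \<and>
    slowly_varying_at_0 (g_fun \<phi> \<phi>') \<and>
    (g_fun \<phi> \<phi>' \<longlongrightarrow> 0) (at_right 0) \<and>
    (\<forall>x :: nat \<Rightarrow> real. (\<forall>i\<in>{1..d}. x i > 0) \<longrightarrow>
      ((\<lambda>s. 1 / (s * g_fun \<phi> \<phi>' s) *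
            measure M {\<omega> \<in> space M. \<forall>i\<in>{1..d}. U i \<omega> \<ge> 1 - s * x i})
        \<longlongrightarrow> (\<Sum>I\<in>{I. I \<noteq> {} \<and> I \<subseteq> {1..d}}. (-1) ^ card I * (\<Sum>i\<in>I. x i) * ln (\<Sum>i\<in>I. x i)))
        (at_right 0) \<and>
      set_integrable (PiM {1..d} (\<lambda>_. lborel)) (PiE {1..d} (\<lambda>i. {0..x i}))
        (\<lambda>t. 1 / (\<Sum>i=1..d. t i) ^ (d - 1)) \<and>
      (\<Sum>I\<in>{I. I \<noteq> {} \<and> I \<subseteq> {1..d}}. (-1) ^ card I * (\<Sum>i\<in>I. x i) * ln (\<Sum>i\<in>I. x i)) =
        fact (d - 2) *
        (LINT t : PiE {1..d} (\<lambda>i. {0..x i}) | PiM {1..d} (\<lambda>_. lborel).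
           1 / (\<Sum>i=1..d. t i) ^ (d - 1)))"
proof -
  interpret de_haan_arch_generator \<phi> \<phi>' using assms by unfold_locales
  \<comment> \<open>The empty set may be added because its term is a product with the factor
    0.\<close>
  have eq: "(\<Sum>I\<in>{I. I \<noteq> {} \<and> I \<subseteq> {1..d}}. (-1) ^ card I * sum x I * ln (sum x I))
      = (\<Sum>I\<in>Pow {1..d}. (-1) ^ card I * (sum x I * ln (sum x I)))" for x :: "nat \<Rightarrow> real"
    by (rule sum.mono_neutral_cong_left) auto
  show ?thesis
    unfolding eq
  proof (intro conjI ballI allI impI)
    fix x :: "nat \<Rightarrow> real" assume "\<forall>i\<in>{1..d}. 0 < x i"
    then have x: "\<And>i. i \<in> {1..d} \<Longrightarrow> 0 < x i" by blast
    note box = integral_box_inverse_power_sum[of "{1..d}" x, OF _ _ x, unfolded card_atLeastAtMost diff_Suc_1]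
    show "((\<lambda>s. 1 / (s * g_fun \<phi> \<phi>' s) * measure M {\<omega> \<in> space M. \<forall>i\<in>{1..d}. U i \<omega> \<ge> 1 - s * x i})
        \<longlongrightarrow> (\<Sum>I\<in>Pow {1..d}. (-1) ^ card I * (sum x I * ln (sum x I)))) (at_right 0)"
      using survival_tendsto[OF assms(1,4,5) x] unfolding g_eq .
    show "set_integrable (PiM {1..d} (\<lambda>_. lborel)) (PiE {1..d} (\<lambda>i. {0..x i}))
        (\<lambda>t. 1 / (\<Sum>i=1..d. t i) ^ (d - 1))"
      by (rule box(1)) (use assms(1) in auto)
    show "(\<Sum>I\<in>Pow {1..d}. (-1) ^ card I * (sum x I * ln (sum x I))) = fact (d - 2) *
        (LINT t : PiE {1..d} (\<lambda>i. {0..x i}) | PiM {1..d} (\<lambda>_. lborel). 1 / (\<Sum>i=1..d. t i) ^ (d - 1))"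
      by (rule box(2)) (use assms(1) in auto)
  next
    fix s :: real assume "s \<in> {0<..<1}"
    then show "0 < g_fun \<phi> \<phi>' s" using g_pos[of s] unfolding g_eq by simp
  next
    show "(g_fun \<phi> \<phi>' \<longlongrightarrow> 0) (at_right 0)" using g_tendsto_0 unfolding g_eq .
  qed (rule slowly_varying_g_fun)
qed

end
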